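(* Let $W_{120}\subset\mathbb S^3$ be the $600$-cell. Then $W_{120}$ is universally optimal: $E_h(W_{120})\le E_h(C)$ for every absolutely monotone $h$ and every $C\subset\mathbb S^3$ with $|C|=120$. If, moreover, $h$ is strictly absolutely monotone in $[-1,1]$ and $C_{120}\subset\mathbb S^3$ is any $120$-point code that is not isometric to $W_{120}$, then $$E_h(W_{120})<E_h(C_{120}).$$
   Context: $\mathbb S^3$ is the unit sphere in $\mathbb R^4$. A code is a finite subset of $\mathbb S^3$; $E_h(C)=\sum_{x\ne y\in C}h(\langle x,y\rangle)$ (sum over ordered pairs of distinct points). A function $h:[-1,1]\to(0,+\infty]$ is absolutely monotone if $h^{(i)}(t)\ge0$ for all $t\in[-1,1)$ and all integers $i\ge0$, and $h(1)=\lim_{t\to1^-}h(t)$. It is strictly absolutely monotone if in addition $h^{(i)}(t)>0$ for all $t\in(-1,1)$ and all $i\ge0$. The $600$-cell $W_{120}$ is the set of $120$ vertices of the regular $600$-cell inscribed in $\mathbb S^3$: with $\varphi=(1+\sqrt5)/2$, it consists of the $8$ permutations of $(\pm1,0,0,0)$, the $16$ points $\frac12(\pm1,\pm1,\pm1,\pm1)$, and the $96$ even permutations of $\frac12(\pm\varphi,\pm1,\pm\varphi^{-1},0)$. Two codes are isometric if one is the image of the other under an orthogonal transformation of $\mathbb R^4$. *)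

theory Defs
  imports "HOL-Analysis.Analysis" "HOL-Combinatorics.Permutations"
begin

definition spherical_code :: "(real ^ 4) set \<Rightarrow> bool" where
  "spherical_code C \<longleftrightarrow> finite C \<and> C \<subseteq> sphere 0 1"

(* Potentials on [-1,1] are total functions with values in ereal; only their values
   on [-1,1] are ever constrained or used. *)
definition energy :: "(real \<Rightarrow> ereal) \<Rightarrow> (real ^ 4) set \<Rightarrow> ereal" where
  "energy h C = (\<Sum>(x, y) \<in> {(x, y). x \<in> C \<and> y \<in> C \<and> x \<noteq> y}. h (x \<bullet> y))"

(* h is finite-valued and smooth on [-1,1), with i-th derivative D i; derivatives at the
   endpoint -1 are one-sided. On [-1,1) the functions D i are uniquely determined by h. *)
definition iterated_derivatives :: "(real \<Rightarrow> ereal) \<Rightarrow> (nat \<Rightarrow> real \<Rightarrow> real) \<Rightarrow> bool" where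
  "iterated_derivatives h D \<longleftrightarrow>
     (\<forall>t \<in> {-1..<1}. h t = ereal (D 0 t)) \<and>
     (\<forall>i. \<forall>t \<in> {-1..<1}. (D i has_real_derivative D (Suc i) t) (at t within {-1..<1}))"

definition absolutely_monotone :: "(real \<Rightarrow> ereal) \<Rightarrow> bool" where
  "absolutely_monotone h \<longleftrightarrow>
     (\<forall>t \<in> {-1..1}. 0 < h t) \<and>
     (\<exists>D. iterated_derivatives h D \<and> (\<forall>i. \<forall>t \<in> {-1..<1}. 0 \<le> D i t)) \<and>
     (h \<longlongrightarrow> h 1) (at_left 1)"

definition strictly_absolutely_monotone :: "(real \<Rightarrow> ereal) \<Rightarrow> bool" where
  "strictly_absolutely_monotone h \<longleftrightarrow>
     absolutely_monotone h \<and>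
     (\<exists>D. iterated_derivatives h D \<and> (\<forall>i. \<forall>t \<in> {-1<..<1}. 0 < D i t))"

definition golden_ratio :: real where
  "golden_ratio = (1 + sqrt 5) / 2"

definition permute_coords :: "(4 \<Rightarrow> 4) \<Rightarrow> real ^ 4 \<Rightarrow> real ^ 4" where
  "permute_coords p v = (\<chi> i. v $ p i)"

definition W120 :: "(real ^ 4) set" where
  "W120 =
     {permute_coords p (vector [s, 0, 0, 0]) | p s.
        p permutes UNIV \<and> s \<in> {1, -1}} \<union>
     {(1 / 2) *\<^sub>R vector [s1, s2, s3, s4] | s1 s2 s3 s4.
        s1 \<in> {1, -1} \<and> s2 \<in> {1, -1} \<and> s3 \<in> {1, -1} \<and> s4 \<in> {1, -1}} \<union>
     {permute_coords p ((1 / 2) *\<^sub>R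
          vector [s1 * golden_ratio, s2, s3 * inverse golden_ratio, 0]) | p s1 s2 s3.
        p permutes UNIV \<and> evenperm p \<and> s1 \<in> {1, -1} \<and> s2 \<in> {1, -1} \<and> s3 \<in> {1, -1}}"

definition isometric_codes :: "(real ^ 4) set \<Rightarrow> (real ^ 4) set \<Rightarrow> bool" where
  "isometric_codes C C' \<longleftrightarrow> (\<exists>f. orthogonal_transformation f \<and> C' = f ` C)"

end

theory Submission
  imports Defs
begin

text \<open>
  With \<open>s = 2t\<close>, the polynomials \<open>chebS n s\<close> are the characters of SU(2), so the kernel
  \<open>chebS n (2 * (x \<bullet> y))\<close> is positive definite on unit quaternions. An absolutely monotone potential is
  expanded in Newton form at the doubled inner products of the 600-cell (the node \<open>-2\<close> once, every other
  node twice): divided differences of absolutely monotone functions are absolutely monotone, so all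
  coefficients and the remainder are nonnegative. It therefore suffices to bound the energy of the Newton
  polynomials of degree at most 14. Those of degree at most 11 have nonnegative Chebyshev coefficients, and
  the 600-cell has vanishing moments of all degrees 1 to 18 except 12. In degrees 12, 13 and 14 a
  nonnegative multiple of the full node polynomial is subtracted in order to cancel the coefficient of degree 12
  while keeping the others nonnegative.

  In the case of equality every inner product of the code is one of the 600-cell and the moments of degrees
  1 to 8 vanish. Then each point \<open>x\<close> has twelve neighbours at angle 36 degrees, and the irrationality of
  the golden ratio forces them to form an icosahedron. A tetrahedron of mutual neighbours determines the
  icosahedron of each of its vertices, and the neighbours of \<open>x\<close> determine those of an adjacent point by
  reflection, so the code is determined up to isometry because the edge graph of the 600-cell is connected.
\<close>

section \<open>Positive definiteness of the Chebyshev kernels\<close>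

text \<open>With s = 2 cos \<theta>, \<open>chebS n s\<close> is sin((n+1)\<theta>) / sin \<theta>.
  Doubling the inner products makes these polynomials monic with integer coefficients and puts all
  data of the 600-cell into Z[phi], so that numerical claims become exact evaluations there. Up to
  isometry the 600-cell is the binary icosahedral group, so its moment of degree k is 120^2 times
  the dimension of the invariants in the k-th symmetric power. Nonconstant invariants occur in
  degree 12 and then not before degree 20. Hence a linear programming bound that is tight for the
  600-cell cannot have a positive coefficient in degree 12, whereas the Newton polynomial of degree
  12 is monic. Multiples of the node polynomial may be subtracted because they vanish on the
  600-cell, and there is room for them up to degree 18. The number 8 in the equality case is the
  degree of the polynomial that vanishes at 2 and at every doubled inner product except the golden
  ratio: moments up to that degree suffice to count neighbours.\<close>

fun chebS :: "nat \<Rightarrow> 'a::comm_ring_1 \<Rightarrow> 'a" where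
  "chebS 0 s = 1"
| "chebS (Suc 0) s = s"
| "chebS (Suc (Suc n)) s = s * chebS (Suc n) s - chebS n s"

lemma chebS_of_real: "chebS n (of_real s :: complex) = of_real (chebS n s)"
  by (induction n "of_real s :: complex" rule: chebS.induct) auto

text \<open>The summands are the eigenvalues of the n-th symmetric power of a matrix with
  eigenvalues l and m. Their sum obeys two first-order recursions, with factors m and l; given l * m
  = 1 these combine to the Chebyshev recursion.\<close>

lemma chebS_eigenvalues:
  fixes l m :: complex
  assumes "l * m = 1"
  shows "(\<Sum>i\<le>n. l ^ i * m ^ (n - i)) = chebS n (l + m)"
proof -
  define T where "T = (\<lambda>n. \<Sum>i\<le>n. l ^ i * m ^ (n - i))"
  have T1: "T (Suc n) = m * T n + l ^ Suc n" for n
    by (simp add: T_def sum_distrib_left Suc_diff_le mult_ac)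
  have T2: "T (Suc n) = l * T n + m ^ Suc n" for n
    by (simp only: T_def sum.atMost_Suc_shift) (simp add: sum_distrib_left mult_ac)
  have T3: "T (Suc (Suc n)) = (l + m) * T (Suc n) - T n" for n
  proof -
    have "m * T (Suc n) = (l * m) * T n + m ^ Suc (Suc n)"
      unfolding T2 by (simp add: algebra_simps)
    moreover have "T (Suc (Suc n)) = l * T (Suc n) + m ^ Suc (Suc n)" by (rule T2)
    ultimately show ?thesis using assms by (simp add: algebra_simps)
  qed
  have "T n = chebS n (l + m)"
    by (induction n "l + m" rule: chebS.induct) (simp_all only: T3 chebS.simps, simp_all add: T_def)
  then show ?thesis by (simp add: T_def)
qed

text \<open>Matrix of the $n$-th symmetric power of the matrix with rows $(a, b)$ and $(c, d)$.\<close>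
definition sympow :: "nat \<Rightarrow> complex \<Rightarrow> complex \<Rightarrow> complex \<Rightarrow> complex \<Rightarrow> nat \<Rightarrow> nat \<Rightarrow> complex" where
  "sympow n a b c d i j =
     (\<Sum>(p, q) \<in> {(p, q). p \<le> i \<and> q \<le> n - i \<and> p + q = j}.
        of_nat (i choose p) * a ^ p * b ^ (i - p) * (of_nat ((n - i) choose q) * c ^ q * d ^ (n - i - q)))"

text \<open>Row i lists the coefficients of the image of u^i v^(n-i) under a linear substitution:
  both powers are expanded binomially and collected by the exponent p + q = j of u.
  \<open>sympow_mult\<close> and \<open>sympow_transpose\<close> follow by comparing
  coefficients.\<close>

lemma sympow_expansion:
  assumes "i \<le> n"
  shows "(\<Sum>j\<le>n. sympow n a b c d i j * (u ^ j * v ^ (n - j))) = (a * u + b * v) ^ i * (c * u + d * v) ^ (n - i)"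
proof -
  define t where "t = (\<lambda>(p, q). of_nat (i choose p) * a ^ p * b ^ (i - p) * (of_nat ((n - i) choose q) * c ^ q * d ^ (n - i - q)))"
  define S where "S = {..i} \<times> {..n - i}"
  have "(\<Sum>j\<le>n. sympow n a b c d i j * (u ^ j * v ^ (n - j)))
      = (\<Sum>j\<in>{..n}. \<Sum>x\<in>{x \<in> S. fst x + snd x = j}. t x * (u ^ (fst x + snd x) * v ^ (n - (fst x + snd x))))"
  proof (rule sum.cong[OF refl])
    fix j
    have "{(p, q). p \<le> i \<and> q \<le> n - i \<and> p + q = j} = {x \<in> S. fst x + snd x = j}"
      by (auto simp: S_def)
    then show "sympow n a b c d i j * (u ^ j * v ^ (n - j)) =
        (\<Sum>x\<in>{x \<in> S. fst x + snd x = j}. t x * (u ^ (fst x + snd x) * v ^ (n - (fst x + snd x))))"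
      by (simp add: sympow_def t_def sum_distrib_right)
  qed
  also have "\<dots> = (\<Sum>x\<in>S. t x * (u ^ (fst x + snd x) * v ^ (n - (fst x + snd x))))"
    by (rule sum.group) (use assms in \<open>auto simp: S_def\<close>)
  also have "\<dots> = (\<Sum>(p, q)\<in>S. (of_nat (i choose p) * (a * u) ^ p * (b * v) ^ (i - p)) * (of_nat ((n - i) choose q) * (c * u) ^ q * (d * v) ^ (n - i - q)))"
  proof (rule sum.cong[OF refl], clarify)
    fix p q assume "(p, q) \<in> S"
    then have "n - (p + q) = (i - p) + (n - i - q)" using assms by (auto simp: S_def)
    then show "t (p, q) * (u ^ (fst (p, q) + snd (p, q)) * v ^ (n - (fst (p, q) + snd (p, q)))) =
      (of_nat (i choose p) * (a * u) ^ p * (b * v) ^ (i - p)) * (of_nat ((n - i) choose q) * (c * u) ^ q * (d * v) ^ (n - i - q))"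
      by (simp add: t_def power_mult_distrib power_add mult_ac)
  qed
  also have "\<dots> = (a * u + b * v) ^ i * (c * u + d * v) ^ (n - i)"
    unfolding binomial_ring sum_product S_def sum.cartesian_product by (simp add: mult_ac)
  finally show ?thesis .
qed

text \<open>Two successive substitutions amount to one substitution by the product matrix; at v = 1
  this is an identity of polynomials in x.\<close>

lemma sympow_mult:
  assumes "i \<le> n" "j \<le> n"
  shows "(\<Sum>k\<le>n. sympow n a b c d i k * sympow n a' b' c' d' k j) =
     sympow n (a * a' + b * c') (a * b' + b * d') (c * a' + d * c') (c * b' + d * d') i j"
    (is "?L j = ?R j")
proof -
  have "(\<Sum>j\<le>n. ?L j * x ^ j) = (\<Sum>j\<le>n. ?R j * x ^ j)" for x
  proof -
    have "(\<Sum>j\<le>n. ?L j * x ^ j) = (\<Sum>k\<le>n. sympow n a b c d i k * (\<Sum>j\<le>n. sympow n a' b' c' d' k j * (x ^ j * 1 ^ (n - j))))"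
      unfolding sum_distrib_left sum_distrib_right
      by (subst sum.swap) (simp add: mult_ac)
    also have "\<dots> = (\<Sum>k\<le>n. sympow n a b c d i k * ((a' * x + b') ^ k * (c' * x + d') ^ (n - k)))"
      by (intro sum.cong refl) (subst sympow_expansion, auto)
    also have "\<dots> = (a * (a' * x + b') + b * (c' * x + d')) ^ i * (c * (a' * x + b') + d * (c' * x + d')) ^ (n - i)"
      by (rule sympow_expansion) fact
    also have "\<dots> = ((a * a' + b * c') * x + (a * b' + b * d') * 1) ^ i * ((c * a' + d * c') * x + (c * b' + d * d') * 1) ^ (n - i)"
      by (simp add: algebra_simps)
    also have "\<dots> = (\<Sum>j\<le>n. ?R j * (x ^ j * 1 ^ (n - j)))"
      by (rule sympow_expansion[symmetric]) fact
    finally show ?thesis by simp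
  qed
  then have "\<forall>j\<le>n. ?L j = ?R j"
    using polyfun_eq_coeffs[where n = n and c = ?L and d = ?R] by blast
  then show ?thesis using assms by blast
qed

text \<open>Both sides are the coefficient of y^i x^j in (a x y + b y + c x + d)^n, which is
  unchanged when b, c and x, y are interchanged together. The binomial weights reflect that
  monomials are orthogonal but not orthonormal for the invariant inner product.\<close>

lemma sympow_transpose:
  assumes "i \<le> n" "j \<le> n"
  shows "of_nat (n choose i) * sympow n a b c d i j = of_nat (n choose j) * sympow n a c b d j i"
proof -
  let ?L = "\<lambda>i j. of_nat (n choose i) * sympow n a b c d i j"
  let ?R = "\<lambda>i j. of_nat (n choose j) * sympow n a c b d j i"
  have L: "(\<Sum>i\<le>n. (\<Sum>j\<le>n. of_nat (n choose i) * sympow n a b c d i j * x ^ j) * y ^ i) = (a * x * y + b * y + c * x + d) ^ n"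
    for a b c d x y :: complex
  proof -
    have "(\<Sum>i\<le>n. (\<Sum>j\<le>n. of_nat (n choose i) * sympow n a b c d i j * x ^ j) * y ^ i)
       = (\<Sum>i\<le>n. of_nat (n choose i) * y ^ i * (\<Sum>j\<le>n. sympow n a b c d i j * (x ^ j * 1 ^ (n - j))))"
      by (simp add: sum_distrib_left sum_distrib_right mult_ac)
    also have "\<dots> = (\<Sum>i\<le>n. of_nat (n choose i) * y ^ i * ((a * x + b) ^ i * (c * x + d) ^ (n - i)))"
      by (intro sum.cong refl) (subst sympow_expansion, auto)
    also have "\<dots> = (\<Sum>i\<le>n. of_nat (n choose i) * (y * (a * x + b)) ^ i * (c * x + d) ^ (n - i))"
      by (simp add: power_mult_distrib mult_ac)
    also have "\<dots> = (y * (a * x + b) + (c * x + d)) ^ n" by (rule binomial_ring[symmetric])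
    finally show ?thesis by (simp add: algebra_simps)
  qed
  have "(\<Sum>i\<le>n. (\<Sum>j\<le>n. ?L i j * x ^ j) * y ^ i) = (\<Sum>i\<le>n. (\<Sum>j\<le>n. ?R i j * x ^ j) * y ^ i)" for x y
  proof -
    have "(\<Sum>i\<le>n. (\<Sum>j\<le>n. ?R i j * x ^ j) * y ^ i)
       = (\<Sum>j\<le>n. (\<Sum>i\<le>n. of_nat (n choose j) * sympow n a c b d j i * y ^ i) * x ^ j)"
      unfolding sum_distrib_right by (subst sum.swap) (simp add: mult_ac)
    then show ?thesis unfolding L by (simp add: algebra_simps)
  qed
  then have "\<forall>i\<le>n. (\<Sum>j\<le>n. ?L i j * x ^ j) = (\<Sum>j\<le>n. ?R i j * x ^ j)" for x
    using polyfun_eq_coeffs[where n = n and c = "\<lambda>i. \<Sum>j\<le>n. ?L i j * x ^ j" and d = "\<lambda>i. \<Sum>j\<le>n. ?R i j * x ^ j"] by blast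
  then have "\<forall>j\<le>n. ?L i j = ?R i j"
    using assms polyfun_eq_coeffs[where n = n and c = "?L i" and d = "?R i"] by blast
  then show ?thesis using assms by blast
qed

lemma sympow_cnj: "cnj (sympow n a b c d i j) = sympow n (cnj a) (cnj b) (cnj c) (cnj d) i j"
  by (simp add: sympow_def case_prod_unfold)

lemma sympow_upper_triangular_diag:
  assumes "i \<le> n" shows "sympow n a b 0 d i i = a ^ i * d ^ (n - i)"
proof -
  let ?S = "{(p, q). p \<le> i \<and> q \<le> n - i \<and> p + q = i}"
  have fin: "finite ?S" by (rule finite_subset[of _ "{..i} \<times> {..n}"]) auto
  have "sympow n a b 0 d i i = (\<Sum>(p, q) \<in> {(i, 0)}.
        of_nat (i choose p) * a ^ p * b ^ (i - p) * (of_nat ((n - i) choose q) * 0 ^ q * d ^ (n - i - q)))"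
    unfolding sympow_def by (rule sum.mono_neutral_right[OF fin]) auto
  then show ?thesis by simp
qed

text \<open>The trace is invariant under conjugation, so the matrix is brought to triangular form;
  unlike diagonalisation this also covers coinciding eigenvalues.\<close>

lemma sympow_trace:
  assumes "a * d - b * c = 1"
  shows "(\<Sum>i\<le>n. sympow n a b c d i i) = chebS n (a + d)"
proof (cases "c = 0")
  case True
  then have "a * d = 1" using assms by simp
  then show ?thesis using chebS_eigenvalues[of a d n] True by (simp add: sympow_upper_triangular_diag)
next
  case False
  define r where "r = csqrt ((a + d)\<^sup>2 - 4)"
  define l m where "l = (a + d + r) / 2" and "m = (a + d - r) / 2"
  have r2: "r\<^sup>2 = (a + d)\<^sup>2 - 4" by (simp add: r_def)
  have lm: "l + m = a + d" by (simp add: l_def m_def field_simps)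
  have lm1: "l * m = 1"
  proof -
    have "l * m = ((a + d)\<^sup>2 - r\<^sup>2) / 4" by (simp add: l_def m_def field_simps power2_eq_square)
    then show ?thesis by (simp add: r2)
  qed
  \<comment> \<open>(v, 1) is an eigenvector for l. The matrix with rows (v, -1) and (1, 0) has
    determinant 1 and inverse (0, 1), (-1, v); conjugation by it yields rows (l, -c) and (0,
    m).\<close>
  define v where "v = (l - d) / c"
  have vc: "v * c = l - d" using False by (simp add: v_def)
  have ev: "a * v + b = l * v"
  proof -
    have "(a * v + b - l * v) * c = a * (l - d) + b * c - l * (l - d)" by (simp add: algebra_simps flip: vc)
    also have "\<dots> = (a * d - l * m) * 0 + (l * (l + m) - l * l - l * d - a * d + b * c) + l * d" 
      unfolding lm by (simp add: algebra_simps)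
    also have "\<dots> = 0" using lm1 assms by (simp add: algebra_simps)
    finally show ?thesis using False by simp
  qed
  have A: "(\<Sum>k\<le>n. sympow n a b c d i k * sympow n v (-1) 1 0 k j) = sympow n (a * v + b) (- a) (c * v + d) (- c) i j"
    if "i \<le> n" "j \<le> n" for i j
    using sympow_mult[OF that, of a b c d v "-1" 1 0] by simp
  have B: "(\<Sum>k\<le>n. sympow n 0 1 (-1) v i k * sympow n (a * v + b) (- a) (c * v + d) (- c) k j) = sympow n l (- c) 0 m i j"
    if "i \<le> n" "j \<le> n" for i j
  proof -
    have e1: "c * v + d = l" using vc by (simp add: algebra_simps)
    have e3: "a - v * c = m" using lm unfolding vc by (simp add: algebra_simps)
    have "sympow n (0 * (a * v + b) + 1 * (c * v + d)) (0 * (- a) + 1 * (- c))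
         ((-1) * (a * v + b) + v * (c * v + d)) ((-1) * (- a) + v * (- c)) i j = sympow n l (- c) 0 m i j"
      using e1 e3 ev by (simp add: algebra_simps)
    then show ?thesis using sympow_mult[OF that, of 0 1 "-1" v "a * v + b" "- a" "c * v + d" "- c"] by simp
  qed
  have Cc: "(\<Sum>k\<le>n. sympow n (a * v + b) (- a) (c * v + d) (- c) i k * sympow n 0 1 (-1) v k j) = sympow n a b c d i j"
    if "i \<le> n" "j \<le> n" for i j
    using sympow_mult[OF that, of "a * v + b" "- a" "c * v + d" "- c" 0 1 "-1" v] by (simp add: algebra_simps)
  have "(\<Sum>i\<le>n. sympow n a b c d i i) = (\<Sum>i\<le>n. \<Sum>k\<le>n. sympow n (a * v + b) (- a) (c * v + d) (- c) i k * sympow n 0 1 (-1) v k i)"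
    by (intro sum.cong refl) (simp add: Cc)
  also have "\<dots> = (\<Sum>i\<le>n. \<Sum>k\<le>n. sympow n 0 1 (-1) v i k * sympow n (a * v + b) (- a) (c * v + d) (- c) k i)"
    by (subst sum.swap) (simp add: mult_ac)
  also have "\<dots> = (\<Sum>i\<le>n. sympow n l (- c) 0 m i i)"
    by (intro sum.cong refl) (simp add: B)
  also have "\<dots> = (\<Sum>i\<le>n. l ^ i * m ^ (n - i))" by (intro sum.cong refl) (simp add: sympow_upper_triangular_diag)
  also have "\<dots> = chebS n (a + d)" by (simp add: chebS_eigenvalues lm1 lm)
  finally show ?thesis .
qed

text \<open>The unit quaternion $x$ acts as the unitary matrix with rows $(a, b)$ and $(-\bar b, \bar a)$;
  the inner product of two unit vectors is half the trace of the quotient.\<close>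
definition quat_entry :: "nat \<Rightarrow> nat \<Rightarrow> nat \<Rightarrow> real ^ 4 \<Rightarrow> complex" where
  "quat_entry n i j x =
     (let a = Complex (x $ 1) (x $ 2); b = Complex (x $ 3) (x $ 4) in sympow n a b (- cnj b) (cnj a) i j)"

lemma inner_real4: "x \<bullet> y = x $ 1 * y $ 1 + x $ 2 * y $ 2 + x $ 3 * y $ 3 + x $ 4 * y $ 4" for x y :: "real ^ 4"
  by (simp add: inner_vec_def sum_4)

text \<open>With X and Y the unitary matrices of x and y, the trace of the symmetric power of X* Y
  is expanded by multiplicativity. The transposition rule rewrites the power of X* as the adjoint of
  the power of X, up to a ratio of binomials.\<close>

lemma chebS_quat_entry:
  fixes x y :: "real ^ 4"
  assumes "norm x = 1" "norm y = 1"
  shows "complex_of_real (chebS n (2 * (x \<bullet> y))) =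
     (\<Sum>i\<le>n. \<Sum>k\<le>n. of_real ((n choose k) / (n choose i)) * (cnj (quat_entry n k i x) * quat_entry n k i y))"
proof -
  define a b a' b' where "a = Complex (x $ 1) (x $ 2)" and "b = Complex (x $ 3) (x $ 4)"
    and "a' = Complex (y $ 1) (y $ 2)" and "b' = Complex (y $ 3) (y $ 4)"
  have nx: "x \<bullet> x = 1" "y \<bullet> y = 1" using assms by (simp_all add: norm_eq_1)
  have dx: "a * cnj a + b * cnj b = 1" and dy: "a' * cnj a' + b' * cnj b' = 1"
    using nx by (simp_all add: complex_eq_iff a_def b_def a'_def b'_def inner_real4)
  define A B where "A = cnj a * a' + b * cnj b'" and "B = cnj a * b' - b * cnj a'"
  have AB: "A * cnj A - B * (- cnj B) = 1"
  proof -
    have "A * cnj A - B * (- cnj B) = (a * cnj a + b * cnj b) * (a' * cnj a' + b' * cnj b')"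
      by (simp add: A_def B_def algebra_simps)
    then show ?thesis by (simp add: dx dy)
  qed
  have tr: "A + cnj A = of_real (2 * (x \<bullet> y))"
    by (simp add: complex_eq_iff A_def a_def b_def a'_def b'_def inner_real4)
  have "complex_of_real (chebS n (2 * (x \<bullet> y))) = chebS n (A + cnj A)"
    unfolding tr chebS_of_real ..
  also have "\<dots> = (\<Sum>i\<le>n. sympow n A B (- cnj B) (cnj A) i i)"
    by (rule sympow_trace[symmetric]) (rule AB)
  also have "\<dots> = (\<Sum>i\<le>n. \<Sum>k\<le>n. sympow n (cnj a) (- b) (cnj b) a i k * sympow n a' b' (- cnj b') (cnj a') k i)"
    by (intro sum.cong refl, subst sympow_mult) (simp_all add: A_def B_def algebra_simps)
  also have "\<dots> = (\<Sum>i\<le>n. \<Sum>k\<le>n. of_real ((n choose k) / (n choose i)) * (cnj (quat_entry n k i x) * quat_entry n k i y))"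
  proof (intro sum.cong refl)
    fix i k assume "i \<in> {..n}" "k \<in> {..n}"
    then have ik: "i \<le> n" "k \<le> n" by auto
    have "of_nat (n choose i) * sympow n (cnj a) (- b) (cnj b) a i k = of_nat (n choose k) * sympow n (cnj a) (cnj b) (- b) a k i"
      by (rule sympow_transpose[OF ik])
    moreover have "sympow n (cnj a) (cnj b) (- b) a k i = cnj (quat_entry n k i x)"
      by (simp add: quat_entry_def Let_def sympow_cnj flip: a_def b_def)
    moreover have "complex_of_nat (n choose i) \<noteq> 0" using ik by (simp add: binomial_eq_0_iff)
    ultimately have "sympow n (cnj a) (- b) (cnj b) a i k = of_real ((n choose k) / (n choose i)) * cnj (quat_entry n k i x)"
      by (simp add: field_simps)
    then show "sympow n (cnj a) (- b) (cnj b) a i k * sympow n a' b' (- cnj b') (cnj a') k i =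
      of_real ((n choose k) / (n choose i)) * (cnj (quat_entry n k i x) * quat_entry n k i y)"
      by (simp add: quat_entry_def Let_def flip: a'_def b'_def)
  qed
  finally show ?thesis .
qed

text \<open>The positive binomial ratio is absorbed as a square root. Taking real parts splits each
  hermitian product into a product of real parts and a product of imaginary parts, which the boolean
  index selects.\<close>

lemma chebS_features:
  obtains I :: "(nat \<times> nat \<times> bool) set" and g :: "nat \<times> nat \<times> bool \<Rightarrow> real ^ 4 \<Rightarrow> real" where "finite I"
    "\<And>x y. norm x = 1 \<Longrightarrow> norm y = 1 \<Longrightarrow> chebS n (2 * (x \<bullet> y)) = (\<Sum>i\<in>I. g i x * g i y)"
proof
  define w where "w = (\<lambda>i k. sqrt ((n choose k) / (n choose i)))"
  have w: "(n choose k) / (n choose i) = w i k * w i k" for i k by (simp add: w_def del: real_sqrt_divide)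
  define g where "g = (\<lambda>(i, k, r) x. w i k * (if r then Re (quat_entry n k i x) else Im (quat_entry n k i x)))"
  show "finite ({..n} \<times> {..n} \<times> (UNIV :: bool set))" by simp
  fix x y :: "real ^ 4" assume xy: "norm x = 1" "norm y = 1"
  have re: "Re (complex_of_real c * (cnj u * v)) = c * (Re u * Re v + Im u * Im v)" for c u v by simp
  have "chebS n (2 * (x \<bullet> y)) = Re (complex_of_real (chebS n (2 * (x \<bullet> y))))" by simp
  also have "\<dots> = (\<Sum>i\<le>n. \<Sum>k\<le>n. (n choose k) / (n choose i) *
      (Re (quat_entry n k i x) * Re (quat_entry n k i y) + Im (quat_entry n k i x) * Im (quat_entry n k i y)))"
    unfolding chebS_quat_entry[OF xy] Re_sum re ..
  also have "\<dots> = (\<Sum>i\<le>n. \<Sum>k\<le>n. \<Sum>r\<in>UNIV. g (i, k, r) x * g (i, k, r) y)"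
    unfolding w UNIV_bool by (simp add: g_def algebra_simps)
  also have "\<dots> = (\<Sum>i\<in>{..n} \<times> {..n} \<times> UNIV. g i x * g i y)"
    by (simp add: sum.cartesian_product case_prod_unfold)
  finally show "chebS n (2 * (x \<bullet> y)) = (\<Sum>i\<in>{..n} \<times> {..n} \<times> UNIV. g i x * g i y)" .
qed

section \<open>Newton expansion of absolutely monotone functions\<close>

definition abs_mono_seq :: "(nat \<Rightarrow> real \<Rightarrow> real) \<Rightarrow> bool" where
  "abs_mono_seq D \<longleftrightarrow> (\<forall>i. \<forall>t\<in>{-1..<1}. (D i has_real_derivative D (Suc i) t) (at t within {-1..<1}) \<and> 0 \<le> D i t)"

definition strict_abs_mono_seq :: "(nat \<Rightarrow> real \<Rightarrow> real) \<Rightarrow> bool" where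
  "strict_abs_mono_seq D \<longleftrightarrow> (\<forall>i. \<forall>t\<in>{-1<..<1}. 0 < D i t)"

text \<open>The $i$-th derivative of the divided difference $(f(t) - f(a)) / (t - a) = \int_0^1 f'(a + s(t - a)) ds$.\<close>
definition divdiff :: "real \<Rightarrow> (nat \<Rightarrow> real \<Rightarrow> real) \<Rightarrow> nat \<Rightarrow> real \<Rightarrow> real" where
  "divdiff a D i t = integral {0..1} (\<lambda>s. s ^ i * D (Suc i) (a + s * (t - a)))"

lemma segment_in_unit_interval: 
  assumes "a \<in> {-1..<1}" "t \<in> {-1..<1}" "s \<in> {0..1}"
  shows "a + s * (t - a) \<in> {-1..<(1::real)}"
proof -
  have "a + s * (t - a) = (1 - s) *\<^sub>R a + s *\<^sub>R t" by (simp add: algebra_simps)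
  also have "\<dots> \<in> {-1..<1}" using assms by (intro convexD) auto
  finally show ?thesis .
qed

lemma abs_mono_seq_continuous:
  assumes "abs_mono_seq D" shows "continuous_on {-1..<1} (D i)"
  using assms unfolding abs_mono_seq_def by (meson DERIV_continuous_on)

lemma divdiff_integrand_continuous:
  assumes "abs_mono_seq D" "a \<in> {-1..<1}"
  shows "continuous_on ({-1..<1} \<times> {0..1}) (\<lambda>(t, s). s ^ i * D j (a + s * (t - a)))"
proof -
  let ?g = "\<lambda>x :: real \<times> real. a + snd x * (fst x - a)"
  have "continuous_on ({-1..<1} \<times> {0..1}) ?g"
    by (intro continuous_intros)
  moreover have "?g ` ({-1..<1} \<times> {0..1}) \<subseteq> {-1..<1}"
    using segment_in_unit_interval[OF assms(2)] by force
  ultimately have "continuous_on ({-1..<1} \<times> {0..1}) (\<lambda>x. D j (?g x))"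
    by (rule continuous_on_compose2[OF abs_mono_seq_continuous[OF assms(1)]])
  then show ?thesis unfolding case_prod_unfold by (intro continuous_intros)
qed

lemma divdiff_integrand_continuous1:
  assumes "abs_mono_seq D" "a \<in> {-1..<1}" "t \<in> {-1..<1}"
  shows "continuous_on {0..1} (\<lambda>s. s ^ i * D j (a + s * (t - a)))"
proof -
  let ?g = "\<lambda>s. a + s * (t - a)"
  have "continuous_on {0..1} ?g"
    by (intro continuous_intros)
  moreover have "?g ` {0..1} \<subseteq> {-1..<1}"
    using segment_in_unit_interval[OF assms(2,3)] by force
  ultimately have "continuous_on {0..1} (\<lambda>s. D j (?g s))"
    by (rule continuous_on_compose2[OF abs_mono_seq_continuous[OF assms(1)]])
  then show ?thesis by (intro continuous_intros)
qed

text \<open>Each differentiation under the integral sign brings down a factor s and raises the order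
  of D by one; the integrand stays nonnegative on [0, 1].\<close>

lemma abs_mono_seq_divdiff:
  assumes D: "abs_mono_seq D" and a: "a \<in> {-1..<1}"
  shows "abs_mono_seq (divdiff a D)"
  unfolding abs_mono_seq_def
proof (intro allI ballI conjI)
  fix i t assume t: "t \<in> {-1..<(1::real)}"
  have der: "((\<lambda>t. s ^ i * D (Suc i) (a + s * (t - a))) has_field_derivative s ^ Suc i * D (Suc (Suc i)) (a + s * (t - a)))
        (at t within {-1..<1})" if "t \<in> {-1..<1}" "s \<in> cbox 0 1" for t s
  proof -
    have "(D (Suc i) has_field_derivative D (Suc (Suc i)) (a + s * (t - a))) (at (a + s * (t - a)) within {-1..<1})"
      using D segment_in_unit_interval[OF a that(1), of s] that(2) unfolding abs_mono_seq_def by auto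
    then have "(D (Suc i) has_field_derivative D (Suc (Suc i)) (a + s * (t - a)))
        (at (a + s * (t - a)) within (\<lambda>t. a + s * (t - a)) ` {-1..<1})"
      by (rule DERIV_subset) (use segment_in_unit_interval[OF a] that(2) in auto)
    moreover have "((\<lambda>t. a + s * (t - a)) has_field_derivative s) (at t within {-1..<1})"
      by (auto intro!: derivative_eq_intros)
    ultimately have "(D (Suc i) \<circ> (\<lambda>t. a + s * (t - a)) has_field_derivative D (Suc (Suc i)) (a + s * (t - a)) * s) (at t within {-1..<1})"
      by (rule DERIV_image_chain)
    from DERIV_cmult[OF this, of "s ^ i"] show ?thesis by (simp add: o_def mult_ac)
  qed
  show "(divdiff a D i has_real_derivative divdiff a D (Suc i) t) (at t within {-1..<1})"
    unfolding divdiff_def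
    by (rule leibniz_rule_field_derivative[where U = "{-1..<1}" and a = 0 and b = "1::real", simplified])
       (use der t divdiff_integrand_continuous[OF D a, of "Suc i"] divdiff_integrand_continuous1[OF D a]
         in \<open>auto intro!: integrable_continuous_real simp: case_prod_unfold\<close>)
  show "0 \<le> divdiff a D i t" unfolding divdiff_def
  proof (rule integral_nonneg)
    show "(\<lambda>s. s ^ i * D (Suc i) (a + s * (t - a))) integrable_on {0..1}"
      by (rule integrable_continuous_real, rule divdiff_integrand_continuous1[OF D a t])
    show "0 \<le> s ^ i * D (Suc i) (a + s * (t - a))" if "s \<in> {0..1}" for s
      using that D segment_in_unit_interval[OF a t that] unfolding abs_mono_seq_def by auto
  qed
qed

lemma strict_abs_mono_seq_divdiff:
  assumes D: "abs_mono_seq D" and S: "strict_abs_mono_seq D" and a: "a \<in> {-1..<1}"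
  shows "strict_abs_mono_seq (divdiff a D)"
  unfolding strict_abs_mono_seq_def
proof (intro allI ballI)
  fix i t assume t: "t \<in> {-1<..<(1::real)}"
  let ?f = "\<lambda>s. s ^ i * D (Suc i) (a + s * (t - a))"
  have c: "continuous_on {0..1} ?f" by (rule divdiff_integrand_continuous1[OF D a]) (use t in auto)
  have nn: "0 \<le> ?f s" if "s \<in> {0..1}" for s
    using that D segment_in_unit_interval[OF a _ that, of t] t unfolding abs_mono_seq_def by auto
  have "integral {0..1} ?f \<noteq> 0"
  proof
    assume "integral {0..1} ?f = 0"
    then have "(?f has_integral 0) (cbox 0 1)"
      using integrable_continuous_real[OF c] by (simp add: has_integral_integral)
    \<comment> \<open>A continuous nonnegative integrand with integral 0 vanishes identically. At s
      = 1 the segment ends in the interior point t, where D is positive even if a = -1.\<close>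
    then have "?f 1 = 0"
      by (rule has_integral_0_cbox_imp_0[rotated 2]) (use c nn in auto)
    moreover have "0 < D (Suc i) t" using S t unfolding strict_abs_mono_seq_def by auto
    ultimately show False by simp
  qed
  moreover have "0 \<le> integral {0..1} ?f"
    by (rule integral_nonneg) (use integrable_continuous_real[OF c] nn in auto)
  ultimately show "0 < divdiff a D i t" by (simp add: divdiff_def)
qed

lemma divdiff_eq:
  assumes D: "abs_mono_seq D" and a: "a \<in> {-1..<1}" and t: "t \<in> {-1..<1}"
  shows "D 0 t = D 0 a + (t - a) * divdiff a D 0 t"
proof -
  have "((\<lambda>s. (t - a) * D 1 (a + s * (t - a))) has_integral (D 0 (a + 1 * (t - a)) - D 0 (a + 0 * (t - a)))) {0..1}"
  proof (rule fundamental_theorem_of_calculus)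
    fix s :: real assume s: "s \<in> {0..1}"
    have "(D 0 has_field_derivative D 1 (a + s * (t - a))) (at (a + s * (t - a)) within {-1..<1})"
      using D segment_in_unit_interval[OF a t s] unfolding abs_mono_seq_def by auto
    then have "(D 0 has_field_derivative D 1 (a + s * (t - a)))
        (at (a + s * (t - a)) within (\<lambda>s. a + s * (t - a)) ` {0..1})"
      by (rule DERIV_subset) (use segment_in_unit_interval[OF a t] in auto)
    moreover have "((\<lambda>s. a + s * (t - a)) has_field_derivative (t - a)) (at s within {0..1})"
      by (auto intro!: derivative_eq_intros)
    ultimately have "(D 0 \<circ> (\<lambda>s. a + s * (t - a)) has_field_derivative D 1 (a + s * (t - a)) * (t - a)) (at s within {0..1})"
      by (rule DERIV_image_chain)
    then show "((\<lambda>s. D 0 (a + s * (t - a))) has_vector_derivative (t - a) * D 1 (a + s * (t - a))) (at s within {0..1})"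
      by (simp add: o_def mult_ac has_real_derivative_iff_has_vector_derivative)
  qed simp
  then show ?thesis by (drule_tac integral_unique) (simp add: divdiff_def)
qed

text \<open>Iterates \<open>divdiff_eq\<close>: c j is the j-fold divided difference evaluated at
  the node \<open>as ! j\<close>, so strict positivity is available where that node lies in the open
  interval. The integral form of \<open>divdiff\<close> makes sense at t = a, so repeated nodes give
  Hermite interpolation without a separate case.\<close>

lemma newton_expansion:
  assumes "abs_mono_seq D" "set as \<subseteq> {-1..<1}"
  shows "\<exists>c R. abs_mono_seq R \<and> (\<forall>j. 0 \<le> c j) \<and>
     (\<forall>t\<in>{-1..<1}. D 0 t = (\<Sum>j<length as. c j * (\<Prod>a\<leftarrow>take j as. t - a)) + (\<Prod>a\<leftarrow>as. t - a) * R 0 t) \<and>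
     (strict_abs_mono_seq D \<longrightarrow> strict_abs_mono_seq R \<and> (\<forall>j<length as. -1 < as ! j \<longrightarrow> 0 < c j))"
  using assms
proof (induction as arbitrary: D)
  case Nil
  then show ?case by (intro exI[of _ "\<lambda>_. 0"] exI[of _ D]) auto
next
  case (Cons a as)
  then have a: "a \<in> {-1..<1}" by auto
  have as: "set as \<subseteq> {-1..<1}" using Cons.prems(2) by simp
  obtain c R where
    R: "abs_mono_seq R" and c: "\<And>j. 0 \<le> c j"
    and eq: "\<And>t. t \<in> {-1..<1} \<Longrightarrow> divdiff a D 0 t = (\<Sum>j<length as. c j * (\<Prod>a\<leftarrow>take j as. t - a)) + (\<Prod>a\<leftarrow>as. t - a) * R 0 t"
    and st: "strict_abs_mono_seq (divdiff a D) \<Longrightarrow> strict_abs_mono_seq R \<and> (\<forall>j<length as. -1 < as ! j \<longrightarrow> 0 < c j)"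
    using Cons.IH[OF abs_mono_seq_divdiff[OF Cons.prems(1) a] as] by blast
  define c' where "c' = (\<lambda>j. case j of 0 \<Rightarrow> D 0 a | Suc j \<Rightarrow> c j)"
  have "0 \<le> D 0 a" using Cons.prems(1) a unfolding abs_mono_seq_def by auto
  then have "0 \<le> c' j" for j using c by (auto simp: c'_def split: nat.split)
  moreover have "D 0 t = (\<Sum>j<length (a # as). c' j * (\<Prod>a\<leftarrow>take j (a # as). t - a)) + (\<Prod>a\<leftarrow>a # as. t - a) * R 0 t"
    if "t \<in> {-1..<1}" for t
    unfolding divdiff_eq[OF Cons.prems(1) a that] eq[OF that] list.size add_Suc_right add_0_right sum.lessThan_Suc_shift
    by (simp add: c'_def algebra_simps sum_distrib_left)
  moreover have "strict_abs_mono_seq R \<and> (\<forall>j<length (a # as). -1 < (a # as) ! j \<longrightarrow> 0 < c' j)" if S: "strict_abs_mono_seq D"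
  proof (intro conjI allI impI)
    note st = st[OF strict_abs_mono_seq_divdiff[OF Cons.prems(1) S a]]
    show "strict_abs_mono_seq R" using st by simp
    fix j assume j: "j < length (a # as)" "-1 < (a # as) ! j"
    show "0 < c' j"
    proof (cases j)
      case 0
      then show ?thesis using S j a by (auto simp: c'_def strict_abs_mono_seq_def)
    next
      case (Suc k)
      then show ?thesis using st j by (auto simp: c'_def)
    qed
  qed
  ultimately show ?case using R by blast
qed

section \<open>The linear programming certificate\<close>

type_synonym zphi = "int \<times> int"

definition zval :: "zphi \<Rightarrow> real" where
  "zval z = of_int (fst z) + of_int (snd z) * golden_ratio"

definition zadd :: "zphi \<Rightarrow> zphi \<Rightarrow> zphi" where
  "zadd z w = (fst z + fst w, snd z + snd w)"

definition zmul :: "zphi \<Rightarrow> zphi \<Rightarrow> zphi" where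
  "zmul z w = (fst z * fst w + snd z * snd w, fst z * snd w + snd z * fst w + snd z * snd w)"

lemma golden_ratio_square: "golden_ratio * golden_ratio = golden_ratio + 1"
proof -
  have "sqrt 5 * sqrt 5 = (5::real)" by simp
  then show ?thesis by (simp add: golden_ratio_def field_simps)
qed

lemma golden_ratio_bounds: "1618 / 1000 < golden_ratio" "golden_ratio < 1619 / 1000"
proof -
  have "2236 / 1000 < sqrt 5" by (rule real_less_rsqrt) (simp add: power2_eq_square)
  then show "1618 / 1000 < golden_ratio" by (simp add: golden_ratio_def)
  have "sqrt 5 < 2238 / 1000" by (rule real_less_lsqrt) (simp_all add: power2_eq_square)
  then show "golden_ratio < 1619 / 1000" by (simp add: golden_ratio_def)
qed

lemma zval_zadd [simp]: "zval (zadd z w) = zval z + zval w"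
  by (simp add: zval_def zadd_def algebra_simps)

lemma zval_zmul [simp]: "zval (zmul z w) = zval z * zval w"
proof -
  have "zval z * zval w = fst z * fst w + (fst z * snd w + snd z * fst w) * golden_ratio
      + snd z * snd w * (golden_ratio * golden_ratio)"
    by (simp add: zval_def algebra_simps)
  then show ?thesis by (simp only: golden_ratio_square) (simp add: zval_def zmul_def algebra_simps)
qed

lemma zval_int [simp]: "zval (n, 0) = of_int n" "zval (0, 1) = golden_ratio"
  by (simp_all add: zval_def)

text \<open>A decidable sufficient test: a linear function that is positive at 1.618 and at 1.619 is
  positive at the golden ratio between them.\<close>

definition zpos :: "zphi \<Rightarrow> bool" where
  "zpos z \<longleftrightarrow> 0 < 1000 * fst z + 1618 * snd z \<and> 0 < 1000 * fst z + 1619 * snd z"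

lemma zpos_imp_pos: assumes "zpos z" shows "0 < zval z"
proof -
  have "0 < 1000 * real_of_int (fst z) + 1618 * snd z" "0 < 1000 * real_of_int (fst z) + 1619 * snd z"
    using assms unfolding zpos_def by linarith+
  moreover have "snd z * (1618 / 1000) \<le> snd z * golden_ratio \<or> snd z * (1619 / 1000) \<le> snd z * golden_ratio"
  proof (cases "0 \<le> snd z")
    case True
    then show ?thesis using golden_ratio_bounds by (intro disjI1 mult_left_mono) auto
  next
    case False
    then show ?thesis using golden_ratio_bounds by (intro disjI2 mult_left_mono_neg) auto
  qed
  ultimately show ?thesis by (auto simp: zval_def)
qed

section \<open>Chebyshev expansions with coefficients in Z[phi]\<close>

fun cheb_comb :: "nat \<Rightarrow> zphi list \<Rightarrow> real \<Rightarrow> real" where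
  "cheb_comb n [] s = 0"
| "cheb_comb n (c # cs) s = zval c * chebS n s + cheb_comb (Suc n) cs s"

fun zplus :: "zphi list \<Rightarrow> zphi list \<Rightarrow> zphi list" where
  "zplus [] ys = ys"
| "zplus xs [] = xs"
| "zplus (x # xs) (y # ys) = zadd x y # zplus xs ys"

abbreviation zscale :: "zphi \<Rightarrow> zphi list \<Rightarrow> zphi list" where
  "zscale c \<equiv> map (zmul c)"

text \<open>Multiplication by s sends the n-th Chebyshev polynomial to the sum of its two
  neighbours, where the one of index -1 is 0. So the list is shifted up once and down once, and
  \<open>tl\<close> drops the term of index -1.\<close>

definition zlinear_mul :: "zphi \<Rightarrow> zphi list \<Rightarrow> zphi list" where
  "zlinear_mul a cs = zplus (zplus ((0, 0) # cs) (tl cs)) (zscale (- fst a, - snd a) cs)"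

lemma cheb_comb_zplus [simp]: "cheb_comb n (zplus xs ys) s = cheb_comb n xs s + cheb_comb n ys s"
  by (induction xs ys arbitrary: n rule: zplus.induct) (simp_all add: algebra_simps)

lemma cheb_comb_zscale [simp]: "cheb_comb n (zscale c xs) s = zval c * cheb_comb n xs s"
  by (induction xs arbitrary: n) (simp_all add: algebra_simps)

lemma cheb_comb_shift: "s * cheb_comb (Suc n) cs s = cheb_comb (Suc (Suc n)) cs s + cheb_comb n cs s"
  by (induction cs arbitrary: n) (simp_all add: algebra_simps)

lemma cheb_comb_linear_mul: "cheb_comb 0 (zlinear_mul a cs) s = (s - zval a) * cheb_comb 0 cs s"
proof -
  have "s * cheb_comb 0 cs s = cheb_comb (Suc 0) cs s + cheb_comb 0 (tl cs) s"
    by (cases cs) (simp_all add: algebra_simps cheb_comb_shift)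
  moreover have "zval (- fst a, - snd a) = - zval a" by (simp add: zval_def)
  moreover have "zval (0, 0) = 0" by (simp add: zval_def)
  ultimately show ?thesis by (simp add: zlinear_mul_def algebra_simps del: zval_int)
qed

lemma cheb_comb_fold_linear_mul:
  "cheb_comb 0 (fold zlinear_mul as cs) s = (\<Prod>a\<leftarrow>as. s - zval a) * cheb_comb 0 cs s"
  by (induction as arbitrary: cs) (simp_all add: cheb_comb_linear_mul)

lemma cheb_comb_sum: "cheb_comb n cs s = (\<Sum>k<length cs. zval (cs ! k) * chebS (n + k) s)"
  by (induction cs arbitrary: n) (simp_all add: sum.lessThan_Suc_shift del: sum.lessThan_Suc)

section \<open>Pair sums and moments of a code\<close>

definition pair_sum :: "(real \<Rightarrow> real) \<Rightarrow> (real ^ 4) set \<Rightarrow> real" where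
  "pair_sum f C = (\<Sum>x\<in>C. \<Sum>y\<in>C. f (2 * (x \<bullet> y)))"

definition offdiag_sum :: "(real \<Rightarrow> real) \<Rightarrow> (real ^ 4) set \<Rightarrow> real" where
  "offdiag_sum f C = (\<Sum>(x, y) \<in> {(x, y). x \<in> C \<and> y \<in> C \<and> x \<noteq> y}. f (2 * (x \<bullet> y)))"

lemma spherical_code_norm: "spherical_code C \<Longrightarrow> x \<in> C \<Longrightarrow> norm x = 1"
  by (auto simp: spherical_code_def)

lemma spherical_code_finite: "spherical_code C \<Longrightarrow> finite C"
  by (auto simp: spherical_code_def)

lemma offdiag_finite: "finite C \<Longrightarrow> finite {(x, y). x \<in> C \<and> y \<in> C \<and> x \<noteq> y}"
  by (rule finite_subset[of _ "C \<times> C"]) auto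

lemma pair_sum_offdiag:
  assumes "spherical_code C"
  shows "pair_sum f C = offdiag_sum f C + real (card C) * f 2"
proof -
  have fin: "finite C" by (rule spherical_code_finite[OF assms])
  let ?O = "{(x, y). x \<in> C \<and> y \<in> C \<and> x \<noteq> y}" and ?D = "(\<lambda>x. (x, x)) ` C"
  have "pair_sum f C = (\<Sum>(x, y)\<in>C \<times> C. f (2 * (x \<bullet> y)))"
    by (simp add: pair_sum_def sum.cartesian_product)
  also have "C \<times> C = ?O \<union> ?D" by auto
  also have "(\<Sum>(x, y)\<in>?O \<union> ?D. f (2 * (x \<bullet> y))) = offdiag_sum f C + (\<Sum>(x, y)\<in>?D. f (2 * (x \<bullet> y)))"
    unfolding offdiag_sum_def using fin offdiag_finite[OF fin] by (intro sum.union_disjoint) auto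
  also have "(\<Sum>(x, y)\<in>?D. f (2 * (x \<bullet> y))) = (\<Sum>x\<in>C. f (2 * (x \<bullet> x)))"
    by (subst sum.reindex) (auto simp: inj_on_def)
  also have "\<dots> = (\<Sum>x\<in>C. f 2)"
    using spherical_code_norm[OF assms] by (intro sum.cong refl) (simp add: norm_eq_1)
  finally show ?thesis by simp
qed

lemma spherical_code_inner_bounds:
  assumes "spherical_code C" "x \<in> C" "y \<in> C" "x \<noteq> y"
  shows "x \<bullet> y \<in> {-1..<1}"
proof -
  have n: "norm x = 1" "norm y = 1" using spherical_code_norm assms by blast+
  have "\<bar>x \<bullet> y\<bar> \<le> 1" using Cauchy_Schwarz_ineq2[of x y] n by simp
  moreover have "x \<bullet> y \<noteq> 1"
  proof
    assume "x \<bullet> y = 1"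
    then have "(x - y) \<bullet> (x - y) = 0" using n by (simp add: norm_eq_1 inner_diff inner_commute)
    then show False using assms by simp
  qed
  ultimately show ?thesis by auto
qed

text \<open>The double sum of a feature expansion factorises. The features are returned as well
  because \<open>moment_zero_pointwise\<close> evaluates them at arbitrary unit vectors.\<close>

lemma pair_sum_chebS_eq_squares:
  assumes "spherical_code C"
  obtains I :: "(nat \<times> nat \<times> bool) set" and g where "finite I"
    "\<And>x y. norm x = 1 \<Longrightarrow> norm y = 1 \<Longrightarrow> chebS n (2 * (x \<bullet> y)) = (\<Sum>i\<in>I. g i x * g i (y :: real ^ 4))"
    "pair_sum (chebS n) C = (\<Sum>i\<in>I. (\<Sum>x\<in>C. g i x)\<^sup>2)"
proof -
  obtain I :: "(nat \<times> nat \<times> bool) set" and g where I: "finite I"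
    and g: "\<And>x y :: real ^ 4. norm x = 1 \<Longrightarrow> norm y = 1 \<Longrightarrow> chebS n (2 * (x \<bullet> y)) = (\<Sum>i\<in>I. g i x * g i y)"
    using chebS_features by blast
  have "pair_sum (chebS n) C = (\<Sum>x\<in>C. \<Sum>y\<in>C. \<Sum>i\<in>I. g i x * g i y)"
    unfolding pair_sum_def using spherical_code_norm[OF assms] by (intro sum.cong refl g) auto
  also have "\<dots> = (\<Sum>x\<in>C. \<Sum>i\<in>I. \<Sum>y\<in>C. g i x * g i y)"
    by (intro sum.cong refl sum.swap)
  also have "\<dots> = (\<Sum>i\<in>I. \<Sum>x\<in>C. \<Sum>y\<in>C. g i x * g i y)"
    by (rule sum.swap)
  also have "\<dots> = (\<Sum>i\<in>I. (\<Sum>x\<in>C. g i x)\<^sup>2)"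
    by (simp add: power2_eq_square sum_product)
  finally show thesis using that I g by blast
qed

lemma pair_sum_chebS_nonneg: "spherical_code C \<Longrightarrow> 0 \<le> pair_sum (chebS n) C"
  by (rule pair_sum_chebS_eq_squares[of C n]) (auto intro!: sum_nonneg)

text \<open>A vanishing sum of squares kills every feature sum, so the moment condition localises at each point.\<close>
lemma moment_zero_pointwise:
  assumes "spherical_code C" "pair_sum (chebS n) C = 0" "norm z = 1"
  shows "(\<Sum>y\<in>C. chebS n (2 * (z \<bullet> y))) = 0"
proof -
  obtain I :: "(nat \<times> nat \<times> bool) set" and g where I: "finite I"
    and g: "\<And>x y :: real ^ 4. norm x = 1 \<Longrightarrow> norm y = 1 \<Longrightarrow> chebS n (2 * (x \<bullet> y)) = (\<Sum>i\<in>I. g i x * g i y)"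
    and s: "pair_sum (chebS n) C = (\<Sum>i\<in>I. (\<Sum>x\<in>C. g i x)\<^sup>2)"
    using pair_sum_chebS_eq_squares[OF assms(1)] by blast
  have 0: "(\<Sum>x\<in>C. g i x) = 0" if "i \<in> I" for i
    using s assms(2) I that sum_nonneg_eq_0_iff[of I "\<lambda>i. (\<Sum>x\<in>C. g i x)\<^sup>2"] by simp
  have "(\<Sum>y\<in>C. chebS n (2 * (z \<bullet> y))) = (\<Sum>y\<in>C. \<Sum>i\<in>I. g i z * g i y)"
    using spherical_code_norm[OF assms(1)] assms(3) by (intro sum.cong refl g) auto
  also have "\<dots> = (\<Sum>i\<in>I. g i z * (\<Sum>y\<in>C. g i y))"
    by (subst sum.swap) (simp add: sum_distrib_left)
  also have "\<dots> = 0" by (simp add: 0)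
  finally show ?thesis .
qed

lemma pair_sum_cheb_comb:
  "pair_sum (cheb_comb 0 cs) C = (\<Sum>k<length cs. zval (cs ! k) * pair_sum (chebS k) C)"
proof -
  have "pair_sum (cheb_comb 0 cs) C = (\<Sum>x\<in>C. \<Sum>y\<in>C. \<Sum>k<length cs. zval (cs ! k) * chebS k (2 * (x \<bullet> y)))"
    by (simp add: pair_sum_def cheb_comb_sum)
  also have "\<dots> = (\<Sum>x\<in>C. \<Sum>k<length cs. \<Sum>y\<in>C. zval (cs ! k) * chebS k (2 * (x \<bullet> y)))"
    by (intro sum.cong refl sum.swap)
  also have "\<dots> = (\<Sum>k<length cs. \<Sum>x\<in>C. \<Sum>y\<in>C. zval (cs ! k) * chebS k (2 * (x \<bullet> y)))"
    by (rule sum.swap)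
  finally show ?thesis by (simp add: pair_sum_def sum_distrib_left)
qed

text \<open>Tailored to the 600-cell, whose moments vanish in degrees 1 to 18 except 12: the
  expansion stops at degree 18, that is length 19, and has no term of degree 12.\<close>

definition lp_feasible :: "zphi list \<Rightarrow> bool" where
  "lp_feasible cs \<longleftrightarrow> length cs \<le> 19 \<and> (\<forall>k<length cs. cs ! k = (0, 0) \<or> k \<noteq> 12 \<and> zpos (cs ! k))"

lemma lp_feasible_coeff:
  assumes "lp_feasible cs" "k < length cs"
  shows "0 \<le> zval (cs ! k)" "k = 12 \<Longrightarrow> zval (cs ! k) = 0"
proof -
  have "cs ! k = (0, 0) \<or> k \<noteq> 12 \<and> zpos (cs ! k)" using assms by (auto simp: lp_feasible_def)
  then show "0 \<le> zval (cs ! k)" "k = 12 \<Longrightarrow> zval (cs ! k) = 0"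
    using zpos_imp_pos[of "cs ! k"] by auto
qed

text \<open>Constant terms and diagonals agree because the codes have equal size, and the remaining
  terms of W vanish. The difference is kept as an identity so that equality can be traced back to
  the moments of C.\<close>

lemma lp_bound:
  assumes C: "spherical_code C" and W: "spherical_code W" and card: "card C = card W"
    and W0: "\<And>k. k \<in> {1..18} - {12} \<Longrightarrow> pair_sum (chebS k) W = 0"
    and cs: "lp_feasible cs"
  shows "offdiag_sum (cheb_comb 0 cs) C - offdiag_sum (cheb_comb 0 cs) W
     = (\<Sum>k\<in>{1..<length cs}. zval (cs ! k) * pair_sum (chebS k) C)"
proof -
  let ?a = "\<lambda>D k. zval (cs ! k) * pair_sum (chebS k) D"
  have split: "(\<Sum>k<length cs. f k) = (\<Sum>k\<in>{1..<length cs}. f k) + (if cs = [] then 0 else f 0)" for f :: "nat \<Rightarrow> real"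
    by (cases cs) (simp_all add: lessThan_atLeast0 sum.atLeast_Suc_lessThan)
  have "?a W k = 0" if "k \<in> {1..<length cs}" for k
    using that W0[of k] lp_feasible_coeff(2)[OF cs] cs by (cases "k = 12") (auto simp: lp_feasible_def)
  then have "(\<Sum>k\<in>{1..<length cs}. ?a W k) = 0" by (intro sum.neutral) blast
  moreover have "pair_sum (chebS 0) W = pair_sum (chebS 0) C" by (simp add: pair_sum_def card)
  ultimately have "pair_sum (cheb_comb 0 cs) C - pair_sum (cheb_comb 0 cs) W = (\<Sum>k\<in>{1..<length cs}. ?a C k)"
    unfolding pair_sum_cheb_comb split by simp
  then show ?thesis using pair_sum_offdiag[OF C] pair_sum_offdiag[OF W] card by simp
qed

lemma lp_bound_nonneg:
  assumes C: "spherical_code C" and W: "spherical_code W" and card: "card C = card W"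
    and W0: "\<And>k. k \<in> {1..18} - {12} \<Longrightarrow> pair_sum (chebS k) W = 0"
    and cs: "lp_feasible cs"
  shows "offdiag_sum (cheb_comb 0 cs) W \<le> offdiag_sum (cheb_comb 0 cs) C"
proof -
  have "0 \<le> (\<Sum>k\<in>{1..<length cs}. zval (cs ! k) * pair_sum (chebS k) C)"
    using lp_feasible_coeff(1)[OF cs] pair_sum_chebS_nonneg[OF C] by (intro sum_nonneg mult_nonneg_nonneg) auto
  then show ?thesis using lp_bound[OF assms] by linarith
qed

section \<open>Newton polynomials at the inner products of the 600-cell\<close>

definition nodes :: "zphi list" where
  "nodes = [(-2, 0), (0, -1), (0, -1), (-1, 0), (-1, 0), (1, -1), (1, -1), (0, 0), (0, 0),
            (-1, 1), (-1, 1), (1, 0), (1, 0), (0, 1), (0, 1)]"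

definition newton_coeffs :: "nat \<Rightarrow> zphi list" where
  "newton_coeffs j = fold zlinear_mul (take j nodes) [(1, 0)]"

definition newton_poly :: "nat \<Rightarrow> real \<Rightarrow> real" where
  "newton_poly j s = (\<Prod>a\<leftarrow>take j nodes. s - zval a)"

lemma newton_poly_cheb_comb: "newton_poly j s = cheb_comb 0 (newton_coeffs j) s"
  by (simp add: newton_poly_def newton_coeffs_def cheb_comb_fold_linear_mul)

text \<open>The double nodes form a square, and the simple factor s + 2 has no sign change on [-2,
  2); this gives the remainder its sign.\<close>

lemma newton_poly_15: "newton_poly 15 s = (s + 2) * ((s + golden_ratio) * (s + 1) * (s - zval (1, -1)) * s *
   (s - zval (-1, 1)) * (s - 1) * (s - golden_ratio))\<^sup>2"
  by (simp add: newton_poly_def nodes_def power2_eq_square zval_def mult_ac)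

definition inner_values :: "real set" where
  "inner_values = zval ` {(-2, 0), (0, -1), (-1, 0), (1, -1), (0, 0), (-1, 1), (1, 0), (0, 1)}"

lemma newton_poly_15_zero_iff: "newton_poly 15 s = 0 \<longleftrightarrow> s \<in> inner_values"
  unfolding newton_poly_15 by (auto simp: inner_values_def zval_def)

lemma newton_poly_15_nonneg: "-2 \<le> s \<Longrightarrow> 0 \<le> newton_poly 15 s"
  unfolding newton_poly_15 by simp

lemma newton_feasible_low: "j < 12 \<Longrightarrow> lp_feasible (newton_coeffs j)"
proof -
  have "\<forall>j\<in>{0..<12}. lp_feasible (newton_coeffs j)" by code_simp
  then show "j < 12 \<Longrightarrow> lp_feasible (newton_coeffs j)" by simp
qed

text \<open>For the three remaining Newton polynomials the moment of degree 12 has to be removed by subtracting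
  a nonnegative multiple of \<open>newton_poly 15\<close>; the multipliers come from a linear program.\<close>
definition corrected_coeffs :: "zphi \<Rightarrow> zphi \<Rightarrow> zphi \<Rightarrow> zphi \<Rightarrow> nat \<Rightarrow> zphi list" where
  "corrected_coeffs n a b c j =
    (let p = zlinear_mul (-2, 0) (newton_coeffs 15); q = zlinear_mul (2, 0) p; r = zlinear_mul (-2, 0) q
     in zplus (zplus (zscale n (newton_coeffs j)) (zscale a p)) (zplus (zscale b q) (zscale c r)))"

text \<open>Relative to the node polynomial the correction is spanned by s + 2, (s + 2)(s - 2) and
  (s + 2)^2 (s - 2). In this basis its sign is visible: for a \<le> 0 and b, c \<ge> 0 the last
  factor is nonpositive on [-2, 2).\<close>

lemma corrected_coeffs_eval:
  "cheb_comb 0 (corrected_coeffs n a b c j) s = zval n * newton_poly j s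
     + newton_poly 15 s * (s + 2) * (zval a + (s - 2) * (zval b + zval c * (s + 2)))"
  by (simp add: corrected_coeffs_def Let_def cheb_comb_linear_mul newton_poly_cheb_comb algebra_simps del: cheb_comb.simps)

text \<open>The factors 16, 8 and 320 clear the denominators of the multipliers. The parameters make
  the coefficient of degree 12 exactly (0, 0).\<close>

lemma corrected_feasible:
  "lp_feasible (corrected_coeffs (16, 0) (-2, 0) (9, 0) (0, 0) 12)"
  "lp_feasible (corrected_coeffs (8, 0) (-2, 0) (9, -2) (0, 0) 13)"
  "lp_feasible (corrected_coeffs (320, 0) (-128, 0) (319, -120) (40, 0) 14)"
  by code_simp+

section \<open>The vertices of the 600-cell\<close>

text \<open>The images of 1, 2 and 3 are split off in turn: b is the image of 1, and the remaining
  factor fixes 1.\<close>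

lemma permutes4_cases:
  assumes "p permutes (UNIV :: 4 set)"
  shows "\<exists>b\<in>{1,2,3,4}. \<exists>c\<in>{2,3,4}. \<exists>d\<in>{3,4}. p = Transposition.transpose 1 b \<circ> (Transposition.transpose 2 c \<circ> Transposition.transpose 3 d)"
proof -
  have U: "UNIV = {1::4, 2, 3, 4}" using exhaust_4 by auto
  have e: "\<exists>b\<in>insert a S. \<exists>q. q permutes S \<and> p = Transposition.transpose a b \<circ> q" if "p permutes insert a S" for p :: "4 \<Rightarrow> 4" and a S
  proof -
    have "p \<in> (\<lambda>(b, p). Transposition.transpose a b \<circ> p) ` {(b, p). b \<in> insert a S \<and> p \<in> {p. p permutes S}}"
      using that permutes_insert[of a S] by blast
    then show ?thesis by auto
  qed
  obtain b q where b: "b \<in> {1,2,3,4}" "q permutes {2,3,4}" "p = Transposition.transpose 1 b \<circ> q"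
    using e[of p 1 "{2,3,4}"] assms unfolding U by blast
  obtain c r where c: "c \<in> {2,3,4}" "r permutes {3,4}" "q = Transposition.transpose 2 c \<circ> r"
    using e[of q 2 "{3,4}"] b by blast
  obtain d u where d: "d \<in> {3,4}" "u permutes {4}" "r = Transposition.transpose 3 d \<circ> u"
    using e[of r 3 "{4}"] c by blast
  have "u = id" using d(2) by simp
  then show ?thesis using b c d by auto
qed

text \<open>A transposition of equal points is the identity, hence even; the nested equivalence says
  that an even number of the three is proper.\<close>

lemma evenperm_transpositions4:
  "evenperm (Transposition.transpose a b \<circ> (Transposition.transpose c d \<circ> Transposition.transpose e f)) \<longleftrightarrow> (a = b) = ((c = d) = (e = f))" for a :: "4"
  by (simp add: evenperm_comp permutation_compose permutation_swap_id evenperm_swap)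

definition even4 :: "(4 \<times> 4 \<times> 4 \<times> 4) set" where
  "even4 = {(1,2,3,4),(1,3,4,2),(1,4,2,3),(2,1,4,3),(3,1,2,4),(4,1,3,2),(2,3,1,4),(2,4,3,1),(3,2,4,1),(3,4,1,2),(4,2,1,3),(4,3,2,1)}"

definition perm4 :: "4 \<Rightarrow> 4 \<Rightarrow> 4 \<Rightarrow> 4 \<times> 4 \<times> 4 \<times> 4" where
  "perm4 b c d = (let p = Transposition.transpose 1 b \<circ> (Transposition.transpose 2 c \<circ> Transposition.transpose 3 d)
     in (p 1, p 2, p 3, p 4))"

lemma perm4_even:
  "perm4 1 2 3 = (1, 2, 3, 4)"
  "perm4 1 3 4 = (1, 3, 4, 2)"
  "perm4 1 4 4 = (1, 4, 2, 3)"
  "perm4 2 2 4 = (2, 1, 4, 3)"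
  "perm4 2 3 3 = (2, 3, 1, 4)"
  "perm4 2 4 3 = (2, 4, 3, 1)"
  "perm4 3 2 4 = (3, 2, 4, 1)"
  "perm4 3 3 3 = (3, 1, 2, 4)"
  "perm4 3 4 3 = (3, 4, 1, 2)"
  "perm4 4 2 4 = (4, 2, 1, 3)"
  "perm4 4 3 3 = (4, 3, 2, 1)"
  "perm4 4 4 3 = (4, 1, 3, 2)"
  by (simp_all add: perm4_def Transposition.transpose_def Let_def)

lemma evenperm4_iff:
  "(\<exists>p. p permutes (UNIV :: 4 set) \<and> evenperm p \<and> t = (p 1, p 2, p 3, p 4)) \<longleftrightarrow> t \<in> even4"
proof
  assume "\<exists>p. p permutes (UNIV :: 4 set) \<and> evenperm p \<and> t = (p 1, p 2, p 3, p 4)"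
  then obtain p where p: "p permutes (UNIV :: 4 set)" "evenperm p" "t = (p 1, p 2, p 3, p 4)" by blast
  from permutes4_cases[OF p(1)] obtain b c d where bcd: "b \<in> {1,2,3,4}" "c \<in> {2,3,4}" "d \<in> {3,4}"
    and e: "p = Transposition.transpose 1 b \<circ> (Transposition.transpose 2 c \<circ> Transposition.transpose 3 d)" by blast
  have t: "t = perm4 b c d" by (simp add: p(3) e perm4_def)
  have ev: "(1 = b) = ((2 = c) = (3 = d))" using p(2) unfolding e evenperm_transpositions4 .
  show "t \<in> even4" using bcd ev unfolding t
    by (elim insertE emptyE; simp add: perm4_even; simp add: even4_def)
next
  have *: "\<exists>p. p permutes (UNIV :: 4 set) \<and> evenperm p \<and> perm4 b c d = (p 1, p 2, p 3, p 4)"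
    if "(1 = b) = ((2 = c) = (3 = d))" for b c d :: 4
    using that by (intro exI[of _ "Transposition.transpose 1 b \<circ> (Transposition.transpose 2 c \<circ> Transposition.transpose 3 d)"])
      (simp add: evenperm_transpositions4 perm4_def permutes_compose permutes_swap_id)
  note ** = *[of 1 2 3] *[of 1 3 4] *[of 1 4 4] *[of 2 2 4] *[of 2 3 3] *[of 2 4 3] *[of 3 2 4] *[of 3 3 3] *[of 3 4 3] *[of 4 2 4] *[of 4 3 3] *[of 4 4 3]
  assume "t \<in> even4"
  then show "\<exists>p. p permutes (UNIV :: 4 set) \<and> evenperm p \<and> t = (p 1, p 2, p 3, p 4)"
    unfolding even4_def by (elim insertE emptyE; simp only:; insert **; simp add: perm4_even)
qed

section \<open>Exact coordinates of the 600-cell, stored doubled so that they lie in Z[phi]\<close>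

type_synonym zvec = "zphi \<times> zphi \<times> zphi \<times> zphi"

fun zvec :: "zvec \<Rightarrow> real ^ 4" where
  "zvec (a, b, c, d) = (1 / 2) *\<^sub>R vector [zval a, zval b, zval c, zval d]"

fun zinner :: "zvec \<Rightarrow> zvec \<Rightarrow> zphi" where
  "zinner (a, b, c, d) (a', b', c', d') = zadd (zadd (zmul a a') (zmul b b')) (zadd (zmul c c') (zmul d d'))"

fun zcoord :: "zvec \<Rightarrow> nat \<Rightarrow> zphi" where
  "zcoord (a, b, c, d) i = (if i = 1 then a else if i = 2 then b else if i = 3 then c else d)"

definition zpermute :: "zvec \<Rightarrow> nat \<times> nat \<times> nat \<times> nat \<Rightarrow> zvec" where
  "zpermute v = (\<lambda>(i, j, k, l). (zcoord v i, zcoord v j, zcoord v k, zcoord v l))"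

definition even_perms :: "(nat \<times> nat \<times> nat \<times> nat) list" where
  "even_perms = [(1,2,3,4),(1,3,4,2),(1,4,2,3),(2,1,4,3),(3,1,2,4),(4,1,3,2),
     (2,3,1,4),(2,4,3,1),(3,2,4,1),(3,4,1,2),(4,2,1,3),(4,3,2,1)]"

text \<open>\<open>(- c, c)\<close> encodes c (phi - 1) = c / phi. In the first block only the
  position of the nonzero coordinate matters, so four permutations are listed and no vertex is
  repeated.\<close>

definition W_list :: "zvec list" where
  "W_list = [zpermute ((s, 0), (0, 0), (0, 0), (0, 0)) t. s \<leftarrow> [2, -2], t \<leftarrow> [(1,2,3,4),(2,1,3,4),(2,3,1,4),(2,3,4,1)]] @
     [((a, 0), (b, 0), (c, 0), (d, 0)). a \<leftarrow> [1, -1], b \<leftarrow> [1, -1], c \<leftarrow> [1, -1], d \<leftarrow> [1, -1]] @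
     [zpermute ((0, a), (b, 0), (- c, c), (0, 0)) t. a \<leftarrow> [1, -1], b \<leftarrow> [1, -1], c \<leftarrow> [1, -1], t \<leftarrow> even_perms]"

lemma vector_4 [simp]:
  "(vector [a, b, c, d] :: 'a::zero ^ 4) $ 1 = a"
  "(vector [a, b, c, d] :: 'a ^ 4) $ 2 = b"
  "(vector [a, b, c, d] :: 'a ^ 4) $ 3 = c"
  "(vector [a, b, c, d] :: 'a ^ 4) $ 4 = d"
  unfolding vector_def by simp_all

lemma inner_zvec: "zvec v \<bullet> zvec w = zval (zinner v w) / 4"
  by (cases v; cases w) (simp add: inner_real4 field_simps)

lemma zval_inverse_golden: "inverse golden_ratio = zval (-1, 1)"
proof -
  have "golden_ratio \<noteq> 0" using golden_ratio_bounds by simp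
  then have "golden_ratio * inverse golden_ratio = 1" by simp
  moreover have "golden_ratio * zval (-1, 1) = 1"
    using golden_ratio_square by (simp add: zval_def algebra_simps)
  ultimately show ?thesis using \<open>golden_ratio \<noteq> 0\<close> by (metis mult_cancel_left)
qed

lemma real4_eqI: "x $ 1 = y $ 1 \<Longrightarrow> x $ 2 = y $ 2 \<Longrightarrow> x $ 3 = y $ 3 \<Longrightarrow> x $ 4 = y $ 4 \<Longrightarrow> x = y" for x y :: "real ^ 4"
  by (simp add: vec_eq_iff forall_4)

lemma zvec_coord: "i \<in> {1, 2, 3, 4} \<Longrightarrow> zvec v $ of_nat i = zval (zcoord v i) / 2"
  by (cases v) auto

lemma zvec_zpermute:
  assumes "{i, j, k, l} \<subseteq> {1, 2, 3, 4}" "(p 1, p 2, p 3, p 4) = (of_nat i, of_nat j, of_nat k, of_nat l)"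
  shows "permute_coords p (zvec v) = zvec (zpermute v (i, j, k, l))"
  using assms zvec_coord[of i v] zvec_coord[of j v] zvec_coord[of k v] zvec_coord[of l v]
  by (intro real4_eqI) (simp_all add: permute_coords_def zpermute_def)

lemma even4_even_perms: "even4 = (\<lambda>(i, j, k, l). (of_nat i, of_nat j, of_nat k, of_nat l)) ` set even_perms"
  by (simp add: even4_def even_perms_def)

lemma even_perms_range: "(i, j, k, l) \<in> set even_perms \<Longrightarrow> {i, j, k, l} \<subseteq> {1, 2, 3, 4}"
  by (auto simp: even_perms_def)

lemma W_block1:
  "{permute_coords p (vector [s, 0, 0, 0]) | p s. p permutes UNIV \<and> s \<in> {1, -1}} =
   zvec ` set [zpermute ((s, 0), (0, 0), (0, 0), (0, 0)) t. s \<leftarrow> [2, -2], t \<leftarrow> [(1,2,3,4),(2,1,3,4),(2,3,1,4),(2,3,4,1)]]"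
  (is "?L = ?R")
proof -
  have "?L = {axis i s | i s. s \<in> {1, -1}}"
  proof (intro equalityI subsetI)
    fix x assume "x \<in> ?L"
    then obtain p s where p: "p permutes UNIV" "s \<in> {1, -1}" "x = permute_coords p (vector [s, 0, 0, 0])" by blast
    have "x = axis (inv p 1) s"
    proof -
      have *: "vector [s, 0, 0, 0] $ j = (if j = 1 then s else 0)" for j :: 4
        using exhaust_4[of j] by auto
      have "(p j = 1) = (j = inv p 1)" for j
        using permutes_inverses[OF p(1)] by metis
      then show ?thesis unfolding p(3) by (simp add: permute_coords_def vec_eq_iff axis_def *)
    qed
    then show "x \<in> {axis i s | i s. s \<in> {1, -1}}" using p by blast
  next
    fix x :: "real ^ 4" assume "x \<in> {axis i s | i s. s \<in> {1, -1}}"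
    then obtain i s where i: "x = axis i s" "s \<in> {1, -1}" by blast
    have *: "vector [s, 0, 0, 0] $ j = (if j = 1 then s else 0)" for j :: 4
      using exhaust_4[of j] by auto
    have "x = permute_coords (Transposition.transpose 1 i) (vector [s, 0, 0, 0])"
      unfolding i by (auto simp: permute_coords_def vec_eq_iff axis_def * Transposition.transpose_def)
    moreover have "Transposition.transpose 1 i permutes UNIV" by (rule permutes_swap_id) auto
    ultimately show "x \<in> ?L" using i by blast
  qed
  also have "\<dots> = (\<lambda>(s, i). axis i s) ` ({1, -1} \<times> {1, 2, 3, 4})"
    unfolding UNIV_4[symmetric] by auto
  also have "\<dots> = ?R"
  proof -
    have "axis (1 :: 4) s = vector [s, 0, 0, 0]" "axis (2 :: 4) s = vector [0, s, 0, 0]" "axis (3 :: 4) s = vector [0, 0, s, 0]" "axis (4 :: 4) s = vector [0, 0, 0, s]"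
      for s :: real by (simp_all add: vec_eq_iff forall_4 axis_def)
    moreover have "(1 / 2) *\<^sub>R vector [2 * a, 2 * b, 2 * c, 2 * d] = (vector [a, b, c, d] :: real ^ 4)" for a b c d
      by (rule real4_eqI) simp_all
    note this[of 1 0 0 0] this[of 0 1 0 0] this[of 0 0 1 0] this[of 0 0 0 1]
      this[of "-1" 0 0 0] this[of 0 "-1" 0 0] this[of 0 0 "-1" 0] this[of 0 0 0 "-1"]
    ultimately show ?thesis by (simp add: zpermute_def insert_commute)
  qed
  finally show ?thesis .
qed

lemma W_block2:
  "{(1 / 2) *\<^sub>R vector [s1, s2, s3, s4] | s1 s2 s3 s4.
        s1 \<in> {1, -1} \<and> s2 \<in> {1, -1} \<and> s3 \<in> {1, -1} \<and> s4 \<in> {1, -1}} =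
   zvec ` set [((a, 0), (b, 0), (c, 0), (d, 0)). a \<leftarrow> [1, -1], b \<leftarrow> [1, -1], c \<leftarrow> [1, -1], d \<leftarrow> [1, -1]]"
  (is "?L = ?R")
proof -
  have "?L = (\<lambda>(a, b, c, d). (1 / 2) *\<^sub>R vector [a, b, c, d]) ` ({1, -1} \<times> {1, -1} \<times> {1, -1} \<times> {1, -1})"
    by (auto simp: image_iff)
  also have "\<dots> = ?R" by (simp add: insert_commute)
  finally show ?thesis .
qed

lemma W_block3:
  "{permute_coords p ((1 / 2) *\<^sub>R vector [s1 * golden_ratio, s2, s3 * inverse golden_ratio, 0]) | p s1 s2 s3.
        p permutes UNIV \<and> evenperm p \<and> s1 \<in> {1, -1} \<and> s2 \<in> {1, -1} \<and> s3 \<in> {1, -1}} =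
   zvec ` set [zpermute ((0, a), (b, 0), (- c, c), (0, 0)) t. a \<leftarrow> [1, -1], b \<leftarrow> [1, -1], c \<leftarrow> [1, -1], t \<leftarrow> even_perms]"
  (is "?L = zvec ` set ?R")
proof -
  let ?v = "\<lambda>a b c. ((0, a), (b, 0), (- c, c), (0, 0)) :: zvec"
  have v: "zvec (?v a b c) = (1 / 2) *\<^sub>R vector [a * golden_ratio, b, c * inverse golden_ratio, 0]" for a b c
    by (simp add: zval_inverse_golden) (simp add: zval_def algebra_simps)
  have setR: "zvec ` set ?R = {zvec (zpermute (?v a b c) t) | a b c t. a \<in> {1, -1} \<and> b \<in> {1, -1} \<and> c \<in> {1, -1} \<and> t \<in> set even_perms}"
  proof -
    have "set ?R = (\<Union>a\<in>{1, -1}. \<Union>b\<in>{1, -1}. \<Union>c\<in>{1, -1}. zpermute (?v a b c) ` set even_perms)"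
      by (simp add: Un_assoc)
    then show ?thesis unfolding image_def by (intro set_eqI) (simp only: UN_iff mem_Collect_eq, blast)
  qed
  show ?thesis unfolding setR
  proof (intro equalityI subsetI)
    fix x assume "x \<in> ?L"
    then obtain p s1 s2 s3 where p: "p permutes (UNIV :: 4 set)" "evenperm p" "s1 \<in> {1, -1}" "s2 \<in> {1, -1}" "s3 \<in> {1, -1}"
      and x: "x = permute_coords p ((1 / 2) *\<^sub>R vector [s1 * golden_ratio, s2, s3 * inverse golden_ratio, 0])" by blast
    obtain a b c :: int where abc: "s1 = a" "s2 = b" "s3 = c" "a \<in> {1, -1}" "b \<in> {1, -1}" "c \<in> {1, -1}"
      using p(3-5) by (metis insert_iff of_int_1 of_int_minus singletonD)
    have "(p 1, p 2, p 3, p 4) \<in> even4" using p(1,2) evenperm4_iff by blast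
    then obtain i j k l where t: "(i, j, k, l) \<in> set even_perms" "(p 1, p 2, p 3, p 4) = (of_nat i, of_nat j, of_nat k, of_nat l)"
      unfolding even4_even_perms by auto
    have "x = zvec (zpermute (?v a b c) (i, j, k, l))"
      unfolding x abc(1-3) v[symmetric] by (rule zvec_zpermute[OF even_perms_range[OF t(1)] t(2)])
    then show "x \<in> {zvec (zpermute (?v a b c) t) | a b c t. a \<in> {1, -1} \<and> b \<in> {1, -1} \<and> c \<in> {1, -1} \<and> t \<in> set even_perms}"
      using abc t by blast
  next
    fix x assume "x \<in> {zvec (zpermute (?v a b c) t) | a b c t. a \<in> {1, -1} \<and> b \<in> {1, -1} \<and> c \<in> {1, -1} \<and> t \<in> set even_perms}"
    then obtain a b c t where abc: "a \<in> {1, -1}" "b \<in> {1, -1}" "c \<in> {1, -1}" "t \<in> set even_perms"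
      "x = zvec (zpermute (?v a b c) t)" by blast
    obtain i j k l where t: "t = (i, j, k, l)" by (cases t)
    have "(of_nat i, of_nat j, of_nat k, of_nat l) \<in> even4"
      unfolding even4_even_perms using abc(4) t by force
    then obtain p where p: "p permutes (UNIV :: 4 set)" "evenperm p" "(of_nat i, of_nat j, of_nat k, of_nat l) = (p 1, p 2, p 3, p 4)"
      using evenperm4_iff by blast
    have "x = permute_coords p (zvec (?v a b c))"
      unfolding abc(5) t by (rule zvec_zpermute[OF even_perms_range p(3)[symmetric], symmetric]) (use abc t in simp)
    then have "x = permute_coords p ((1 / 2) *\<^sub>R vector [of_int a * golden_ratio, of_int b, of_int c * inverse golden_ratio, 0])"
      unfolding v .
    moreover have "real_of_int a \<in> {1, -1}" "real_of_int b \<in> {1, -1}" "real_of_int c \<in> {1, -1}" using abc by auto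
    ultimately show "x \<in> ?L" using p by blast
  qed
qed

lemma W120_eq: "W120 = zvec ` set W_list"
  unfolding W120_def W_block1 W_block2 W_block3 W_list_def set_append image_Un Un_assoc ..

text \<open>The layers of the 600-cell as seen from a vertex; 2 belongs to the vertex itself and -2
  to its antipode.\<close>

definition profile :: "(zphi \<times> nat) list" where
  "profile = [((0, 0), 30), ((1, 0), 20), ((-1, 0), 20), ((0, 1), 12), ((0, -1), 12),
     ((1, -1), 12), ((-1, 1), 12), ((2, 0), 1), ((-2, 0), 1)]"

text \<open>\<open>zinner\<close> is four times the inner product while the keys of \<open>profile\<close> are twice the inner product,
  hence the key \<open>v\<close> is matched against \<open>zadd v v\<close>.\<close>
fun has_profile :: "zphi list \<Rightarrow> (zphi \<times> nat) list \<Rightarrow> bool" where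
  "has_profile xs [] \<longleftrightarrow> xs = []"
| "has_profile xs ((v, n) # ps) \<longleftrightarrow>
     (let ys = filter (\<lambda>x. x \<noteq> zadd v v) xs in length xs = length ys + n \<and> has_profile ys ps)"

lemma has_profile_sum:
  "has_profile xs ps \<Longrightarrow> (\<Sum>x\<leftarrow>xs. F (zval x / 2)) = (\<Sum>(v, n)\<leftarrow>ps. real n * F (zval v))"
proof (induction xs ps rule: has_profile.induct)
  case (2 xs v n ps)
  define ys where "ys = filter (\<lambda>x. x \<noteq> zadd v v) xs"
  have len: "length xs = length ys + n" and ys: "has_profile ys ps"
    using 2(2) by (simp_all add: ys_def Let_def)
  have *: "(\<Sum>x\<leftarrow>xs. F (zval x / 2)) + real (length ys) * F (zval v) = (\<Sum>x\<leftarrow>ys. F (zval x / 2)) + real (length xs) * F (zval v)"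
    unfolding ys_def by (induction xs) (auto simp: algebra_simps)
  show ?case using 2(1)[OF ys_def ys] * len by (simp add: algebra_simps)
qed simp

lemma has_profile_set: "has_profile xs ps \<Longrightarrow> set xs \<subseteq> (\<lambda>v. zadd v v) ` fst ` set ps"
proof (induction xs ps rule: has_profile.induct)
  case (2 xs v n ps)
  define ys where "ys = filter (\<lambda>x. x \<noteq> zadd v v) xs"
  have ys: "has_profile ys ps" using 2(2) by (simp add: ys_def Let_def)
  show ?case using 2(1)[OF ys_def ys] unfolding ys_def by auto
qed simp

text \<open>Vertex transitivity is replaced by evaluation: every row of the Gram matrix is checked
  to have the same distribution, in three blocks.\<close>

lemma W_rows_1: "list_all (\<lambda>x. has_profile (map (zinner x) W_list) profile) (take 40 W_list)"
  by code_simp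
lemma W_rows_2: "list_all (\<lambda>x. has_profile (map (zinner x) W_list) profile) (take 40 (drop 40 W_list))"
  by code_simp
lemma W_rows_3: "list_all (\<lambda>x. has_profile (map (zinner x) W_list) profile) (drop 80 W_list)"
  by code_simp

lemma distinct_W_list: "distinct W_list" by code_simp

lemma length_W_list: "length W_list = 120" by code_simp

text \<open>An integer stand-in for the first coordinate, with 8/5 in place of the golden ratio; the
  pole \<open>axis 1 1\<close> gets height 10.\<close>

definition zheight :: "zvec \<Rightarrow> int" where
  "zheight v = 5 * fst (fst v) + 8 * snd (fst v)"

text \<open>A certificate that the edge graph is connected: climbing from neighbour to higher
  neighbour ends at the pole. The value (0, 2) is four times the inner product phi / 2.\<close>

lemma W_climb: "list_all (\<lambda>x. zheight x = 10 \<and> x = ((2, 0), (0, 0), (0, 0), (0, 0)) \<or> zheight x < 10 \<and>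
     list_ex (\<lambda>y. zheight x < zheight y \<and> zinner x y = (0, 2)) W_list) W_list"
  by code_simp

lemma zval_eq_0_iff: "zval z = 0 \<longleftrightarrow> z = (0, 0)"
proof
  assume z: "zval z = 0"
  define m n where "m = 2 * fst z + snd z" and "n = snd z"
  have "of_int m + of_int n * sqrt 5 = 2 * zval z"
    by (simp add: m_def n_def zval_def golden_ratio_def field_simps)
  then have "of_int m = - (of_int n * sqrt 5)" using z by simp
  then have "(of_int m)\<^sup>2 = (of_int n * sqrt 5)\<^sup>2" by simp
  then have "real_of_int (m\<^sup>2) = real_of_int (5 * n\<^sup>2)" by (simp add: power_mult_distrib)
  then have e: "m\<^sup>2 = 5 * n\<^sup>2" by (simp only: of_int_eq_iff)
  have "n = 0"
  proof (rule ccontr)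
    assume n: "n \<noteq> 0"
    then have m: "m \<noteq> 0" using e by auto
    have p: "prime_elem (5 :: int)" by simp
    \<comment> \<open>The exponent of 5 is even in m^2 and odd in 5 n^2.\<close>
    have "multiplicity 5 (m\<^sup>2) = 2 * multiplicity 5 m"
      using p m by (rule prime_elem_multiplicity_power_distrib)
    moreover have "multiplicity 5 (5 * n\<^sup>2) = 1 + 2 * multiplicity 5 n"
      using n p by (simp add: prime_elem_multiplicity_mult_distrib prime_elem_multiplicity_power_distrib)
    ultimately have "2 * multiplicity 5 m = 1 + 2 * multiplicity 5 n" using e by simp
    then show False by presburger
  qed
  then show "z = (0, 0)" using e by (simp add: m_def n_def prod_eq_iff)
qed simp

lemma zval_inj: "zval z = zval w \<longleftrightarrow> z = w"
proof -
  have "zval z - zval w = zval (fst z - fst w, snd z - snd w)" by (simp add: zval_def algebra_simps)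
  then show ?thesis using zval_eq_0_iff[of "(fst z - fst w, snd z - snd w)"] by (auto simp: prod_eq_iff)
qed

lemma inj_zvec: "inj zvec"
proof (rule injI)
  fix v w assume *: "zvec v = zvec w"
  have "zcoord v i = zcoord w i" if "i \<in> {1, 2, 3, 4}" for i
    using zvec_coord[OF that, of v] zvec_coord[OF that, of w] * by (simp add: zval_inj)
  from this[of 1] this[of 2] this[of 3] this[of 4] show "v = w" by (cases v; cases w) auto
qed

lemma card_W120: "card W120 = 120"
  unfolding W120_eq using inj_zvec distinct_W_list length_W_list
  by (subst card_image) (auto intro: inj_on_subset simp: distinct_card)

lemma sum_W120: "sum F W120 = (\<Sum>v\<leftarrow>W_list. F (zvec v))"
  unfolding W120_eq using inj_zvec distinct_W_list
  by (subst sum.reindex) (auto intro: inj_on_subset simp: sum.distinct_set_conv_list)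

lemma W_norms: "list_all (\<lambda>x. zinner x x = (4, 0)) W_list" by code_simp

lemma spherical_code_W120: "spherical_code W120"
proof -
  have "norm x = 1" if "x \<in> W120" for x
  proof -
    obtain v where v: "v \<in> set W_list" "x = zvec v" using \<open>x \<in> W120\<close> unfolding W120_eq by blast
    then have "zinner v v = (4, 0)" using W_norms by (auto simp: list_all_iff)
    then show ?thesis unfolding v(2) norm_eq_1 inner_zvec by simp
  qed
  moreover have "finite W120" by (simp add: W120_eq)
  ultimately show ?thesis by (auto simp: spherical_code_def)
qed

lemma W_rows: assumes "x \<in> set W_list" shows "has_profile (map (zinner x) W_list) profile"
proof -
  have "drop 80 W_list = drop 40 (drop 40 W_list)" by simp
  then have "set (take 40 W_list) \<union> (set (take 40 (drop 40 W_list)) \<union> set (drop 80 W_list)) = set W_list"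
    unfolding set_append[symmetric] by (simp only: append_take_drop_id)
  then have "x \<in> set (take 40 W_list) \<or> x \<in> set (take 40 (drop 40 W_list)) \<or> x \<in> set (drop 80 W_list)"
    using assms by blast
  then show ?thesis
    by (elim disjE; intro bspec[OF W_rows_1[unfolded list_all_iff]] bspec[OF W_rows_2[unfolded list_all_iff]]
      bspec[OF W_rows_3[unfolded list_all_iff]])
qed

lemma W120_row_sum:
  assumes "x \<in> W120"
  shows "(\<Sum>y\<in>W120. F (2 * (x \<bullet> y))) = (\<Sum>(v, n)\<leftarrow>profile. real n * F (zval v))"
proof -
  obtain v where v: "v \<in> set W_list" "x = zvec v" using assms by (auto simp: W120_eq)
  have "(\<Sum>y\<in>W120. F (2 * (x \<bullet> y))) = (\<Sum>z\<leftarrow>map (zinner v) W_list. F (zval z / 2))"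
    by (simp add: sum_W120 v(2) inner_zvec o_def)
  then show ?thesis using has_profile_sum[OF W_rows[OF v(1)]] by simp
qed

lemma W120_inner_values:
  assumes "x \<in> W120" "y \<in> W120" "x \<noteq> y"
  shows "2 * (x \<bullet> y) \<in> inner_values"
proof -
  obtain v w where v: "v \<in> set W_list" "x = zvec v" and w: "w \<in> set W_list" "y = zvec w"
    using assms by (auto simp: W120_eq)
  obtain z where z: "z \<in> fst ` set profile" "zinner v w = zadd z z"
  proof -
    have "zinner v w \<in> (\<lambda>z. zadd z z) ` fst ` set profile"
      using has_profile_set[OF W_rows[OF v(1)]] w(1) unfolding set_map by blast
    then show thesis using that by blast
  qed
  have e: "2 * (x \<bullet> y) = zval z" by (simp add: v w inner_zvec z(2))
  moreover have "x \<bullet> y \<noteq> 1" using spherical_code_inner_bounds[OF spherical_code_W120 assms] by auto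
  ultimately have "z \<noteq> (2, 0)" by auto
  then have "z \<in> {(-2, 0), (0, -1), (-1, 0), (1, -1), (0, 0), (-1, 1), (1, 0), (0, 1)}"
    using z(1) by (auto simp: profile_def)
  then show ?thesis unfolding e inner_values_def by (rule imageI)
qed

section \<open>Moments of the 600-cell\<close>

fun zcheb :: "nat \<Rightarrow> zphi \<Rightarrow> zphi" where
  "zcheb 0 s = (1, 0)"
| "zcheb (Suc 0) s = s"
| "zcheb (Suc (Suc n)) s = zadd (zmul s (zcheb (Suc n) s)) (zmul (-1, 0) (zcheb n s))"

lemma zval_zcheb: "zval (zcheb n s) = chebS n (zval s)"
  by (induction n s rule: zcheb.induct) simp_all

fun profile_moment :: "nat \<Rightarrow> (zphi \<times> nat) list \<Rightarrow> zphi" where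
  "profile_moment k [] = (0, 0)"
| "profile_moment k ((v, n) # ps) = zadd (zmul (int n, 0) (zcheb k v)) (profile_moment k ps)"

lemma zval_profile_moment: "zval (profile_moment k ps) = (\<Sum>(v, n)\<leftarrow>ps. real n * chebS k (zval v))"
  by (induction k ps rule: profile_moment.induct) (simp_all add: zval_zcheb)

lemma profile_moments: "\<forall>k\<in>set [1,2,3,4,5,6,7,8,9,10,11,13,14,15,16,17,18]. profile_moment k profile = (0, 0)"
  by code_simp

lemma W120_moments:
  assumes "k \<in> {1..18} - {12}"
  shows "pair_sum (chebS k) W120 = 0"
proof -
  have "k \<in> set [1,2,3,4,5,6,7,8,9,10,11,13,14,15,16,17,18]" using assms unfolding set_simps insert_iff by simp presburger
  then have "profile_moment k profile = (0, 0)" using profile_moments by blast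
  then have "(\<Sum>(v, n)\<leftarrow>profile. real n * chebS k (zval v)) = 0"
    using zval_profile_moment[of k profile] by simp
  then show ?thesis unfolding pair_sum_def by (simp add: W120_row_sum)
qed

lemma W120_connected_induct:
  assumes base: "P (axis 1 1)"
    and step: "\<And>x y. x \<in> W120 \<Longrightarrow> y \<in> W120 \<Longrightarrow> 2 * (x \<bullet> y) = golden_ratio \<Longrightarrow> P y \<Longrightarrow> P x"
    and x: "x \<in> W120"
  shows "P x"
proof -
  have "P (zvec v)" if "v \<in> set W_list" for v
    using that
  proof (induction "nat (10 - zheight v)" arbitrary: v rule: less_induct)
    case less
    from bspec[OF W_climb[unfolded list_all_iff] less.prems]
    consider "v = ((2, 0), (0, 0), (0, 0), (0, 0))" | w where "zheight v < 10" "w \<in> set W_list" "zheight v < zheight w" "zinner v w = (0, 2)"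
      unfolding list_ex_iff by blast
    then show ?case
    proof cases
      case 1
      have "zvec v = axis 1 1" unfolding 1 by (simp add: vec_eq_iff forall_4 axis_def)
      then show ?thesis using base by simp
    next
      case 2
      have "zval (0, 2) = 2 * golden_ratio" by (simp add: zval_def)
      then have "2 * (zvec v \<bullet> zvec w) = golden_ratio" by (simp add: inner_zvec 2(4))
      moreover have "P (zvec w)" using 2 less by auto
      ultimately show ?thesis using step[of "zvec v" "zvec w"] less.prems 2(2) by (auto simp: W120_eq)
    qed
  qed
  then show ?thesis using x by (auto simp: W120_eq)
qed

lemma axis_1_in_W120: "axis 1 1 \<in> W120"
proof -
  have "((2, 0), (0, 0), (0, 0), (0, 0)) \<in> set W_list" by (simp add: W_list_def zpermute_def)
  moreover have "zvec ((2, 0), (0, 0), (0, 0), (0, 0)) = axis 1 1" by (simp add: vec_eq_iff forall_4 axis_def)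
  ultimately show ?thesis unfolding W120_eq by (metis imageI)
qed

section \<open>The energy bound\<close>

lemma offdiag_sum_add: "offdiag_sum (\<lambda>s. f s + g s) C = offdiag_sum f C + offdiag_sum g C"
  by (simp add: offdiag_sum_def sum.distrib case_prod_unfold)

lemma offdiag_sum_cmult: "offdiag_sum (\<lambda>s. c * f s) C = c * offdiag_sum f C"
  by (simp add: offdiag_sum_def sum_distrib_left case_prod_unfold)

lemma offdiag_sum_sum: "offdiag_sum (\<lambda>s. \<Sum>j\<in>J. f j s) C = (\<Sum>j\<in>J. offdiag_sum (f j) C)"
  unfolding offdiag_sum_def case_prod_unfold by (rule sum.swap)

lemma offdiag_sum_cong:
  assumes "spherical_code C" "\<And>s. s \<in> {-2..<2} \<Longrightarrow> f s = g s"
  shows "offdiag_sum f C = offdiag_sum g C"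
  unfolding offdiag_sum_def
proof (intro sum.cong refl, clarify)
  fix x y assume "x \<in> C" "y \<in> C" "x \<noteq> y"
  then show "f (2 * (x \<bullet> y)) = g (2 * (x \<bullet> y))"
    using spherical_code_inner_bounds[OF assms(1), of x y] by (intro assms(2)) auto
qed

lemma offdiag_sum_nonneg:
  assumes "spherical_code C" "\<And>s. s \<in> {-2..<2} \<Longrightarrow> 0 \<le> f s"
  shows "0 \<le> offdiag_sum f C"
  unfolding offdiag_sum_def
proof (rule sum_nonneg, clarify)
  fix x y assume "x \<in> C" "y \<in> C" "x \<noteq> y"
  then show "0 \<le> f (2 * (x \<bullet> y))"
    using spherical_code_inner_bounds[OF assms(1), of x y] by (intro assms(2)) auto
qed

lemma offdiag_sum_W120_vanishing:
  "(\<And>s. s \<in> inner_values \<Longrightarrow> f s = 0) \<Longrightarrow> offdiag_sum f W120 = 0"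
  unfolding offdiag_sum_def by (rule sum.neutral) (use W120_inner_values in auto)

lemma energy_eq_offdiag_sum:
  assumes "spherical_code C" "\<And>t. t \<in> {-1..<1} \<Longrightarrow> h t = ereal (d t)"
  shows "energy h C = ereal (offdiag_sum (\<lambda>s. d (s / 2)) C)"
proof -
  have "energy h C = (\<Sum>(x, y) \<in> {(x, y). x \<in> C \<and> y \<in> C \<and> x \<noteq> y}. ereal (d (x \<bullet> y)))"
    unfolding energy_def using spherical_code_inner_bounds[OF assms(1)] assms(2) by (intro sum.cong refl) auto
  then show ?thesis by (simp add: offdiag_sum_def case_prod_unfold)
qed

lemma newton_poly_bound:
  assumes C: "spherical_code C" and card: "card C = 120" and j: "j < 15"
  shows "offdiag_sum (newton_poly j) W120 \<le> offdiag_sum (newton_poly j) C"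
proof -
  have card': "card C = card W120" by (simp add: card card_W120)
  note lp = lp_bound_nonneg[OF C spherical_code_W120 card' W120_moments]
  have corrected: ?thesis
    if n: "0 < zval n" and feas: "lp_feasible (corrected_coeffs n a b c j)"
      and sgn: "\<And>s. s \<in> {-2..<2} \<Longrightarrow> zval a + (s - 2) * (zval b + zval c * (s + 2)) \<le> 0" for n a b c
  proof -
    let ?F = "cheb_comb 0 (corrected_coeffs n a b c j)"
    \<comment> \<open>The negated correction: nonnegative on [-2, 2) and zero at the inner products
      of the 600-cell. So n times the Newton polynomial is a feasible polynomial plus a term whose
      sum vanishes for the 600-cell and is nonnegative for C.\<close>
    let ?q = "\<lambda>s. newton_poly 15 s * (s + 2) * - (zval a + (s - 2) * (zval b + zval c * (s + 2)))"
    have split: "zval n * offdiag_sum (newton_poly j) D = offdiag_sum ?F D + offdiag_sum ?q D" for D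
    proof -
      have "(\<lambda>s. zval n * newton_poly j s) = (\<lambda>s. ?F s + ?q s)"
        unfolding corrected_coeffs_eval mult_minus_right by simp
      then show ?thesis unfolding offdiag_sum_cmult[symmetric] offdiag_sum_add[symmetric] by simp
    qed
    have "offdiag_sum ?q W120 = 0"
      by (rule offdiag_sum_W120_vanishing) (use newton_poly_15_zero_iff in auto)
    moreover have "0 \<le> offdiag_sum ?q C"
    proof (rule offdiag_sum_nonneg[OF C])
      fix s :: real assume s: "s \<in> {-2..<2}"
      then show "0 \<le> newton_poly 15 s * (s + 2) * - (zval a + (s - 2) * (zval b + zval c * (s + 2)))"
        using sgn[OF s] newton_poly_15_nonneg[of s] by (intro mult_nonneg_nonneg) auto
    qed
    ultimately have "zval n * offdiag_sum (newton_poly j) W120 \<le> zval n * offdiag_sum (newton_poly j) C"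
      unfolding split using lp[OF _ feas] by simp
    then show ?thesis using n by simp
  qed
  have *: "zval a + (s - 2) * (zval b + zval c * (s + 2)) \<le> 0"
    if "zval a \<le> 0" "0 \<le> zval b" "0 \<le> zval c" "s \<in> {-2..<2}" for a b c s
  proof -
    have "(2 - s) * (zval b + zval c * (s + 2)) \<ge> 0"
      using that by (intro mult_nonneg_nonneg[of "2 - s"] add_nonneg_nonneg[of "zval b"] mult_nonneg_nonneg[of "zval c"]) auto
    then show ?thesis using that(1) by (simp add: algebra_simps)
  qed
  have zs: "zval (9, -2) \<ge> 0" "zval (319, -120) \<ge> 0"
    by (rule less_imp_le, rule zpos_imp_pos, simp add: zpos_def)+
  consider "j < 12" | "j = 12" | "j = 13" | "j = 14" using j by linarith
  then show ?thesis
  proof cases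
    case 1
    have "newton_poly j = cheb_comb 0 (newton_coeffs j)" by (rule ext) (rule newton_poly_cheb_comb)
    then show ?thesis using lp[OF _ newton_feasible_low[OF 1]] by simp
  next
    case 2
    show ?thesis by (rule corrected[OF _ corrected_feasible(1)[folded 2]]) (simp, rule *, auto)
  next
    case 3
    show ?thesis by (rule corrected[OF _ corrected_feasible(2)[folded 3]]) (simp, rule *, use zs in auto)
  next
    case 4
    show ?thesis by (rule corrected[OF _ corrected_feasible(3)[folded 4]]) (simp, rule *, use zs in auto)
  qed
qed

lemma nodes_range: "a \<in> set nodes \<Longrightarrow> zval a / 2 \<in> {-1..<1}"
  using golden_ratio_bounds by (auto simp: nodes_def zval_def)

lemma newton_energy:
  assumes D: "abs_mono_seq D"
  shows "\<exists>c R. (\<forall>j. 0 \<le> c j) \<and> (\<forall>s\<in>{-2..<2}. 0 \<le> R s \<and>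
      D 0 (s / 2) = (\<Sum>j<15. c j * newton_poly j s) + newton_poly 15 s * R s) \<and>
    (strict_abs_mono_seq D \<longrightarrow> 0 < c 8 \<and> (\<forall>s\<in>{-2<..<2}. 0 < R s))"
proof -
  let ?as = "map (\<lambda>a. zval a / 2) nodes"
  \<comment> \<open>Passing from t to s = 2t costs a factor 1/2 per node, hence the powers of 2 in
    the witnesses below.\<close>
  have scale: "(\<Prod>a\<leftarrow>map (\<lambda>a. zval a / 2) zs. s / 2 - a) = (\<Prod>a\<leftarrow>zs. s - zval a) / 2 ^ length zs" for zs and s :: real
    by (induction zs) (simp_all add: field_simps)
  have len: "length nodes = 15" by (simp add: nodes_def)
  have "set ?as \<subseteq> {-1..<1}" using nodes_range by auto
  from newton_expansion[OF D this] obtain c R where R: "abs_mono_seq R" and c: "\<And>j. 0 \<le> c j"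
    and eq: "\<And>t. t \<in> {-1..<1} \<Longrightarrow> D 0 t = (\<Sum>j<length ?as. c j * (\<Prod>a\<leftarrow>take j ?as. t - a)) + (\<Prod>a\<leftarrow>?as. t - a) * R 0 t"
    and st: "strict_abs_mono_seq D \<Longrightarrow> strict_abs_mono_seq R \<and> (\<forall>j<length ?as. -1 < ?as ! j \<longrightarrow> 0 < c j)"
    by blast
  show ?thesis
  proof (intro exI[of _ "\<lambda>j. c j / 2 ^ j"] exI[of _ "\<lambda>s. R 0 (s / 2) / 2 ^ 15"] conjI allI ballI impI)
    show "0 \<le> c j / 2 ^ j" for j using c by simp
    show "0 \<le> R 0 (s / 2) / 2 ^ 15" if "s \<in> {-2..<2}" for s
      using R that unfolding abs_mono_seq_def by simp
    show "0 < R 0 (s / 2) / 2 ^ 15" if "strict_abs_mono_seq D" "s \<in> {-2<..<2}" for s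
      using st[OF that(1)] that(2) unfolding strict_abs_mono_seq_def by simp
    \<comment> \<open>\<open>nodes ! 8\<close> is 0 and thus interior, so the corresponding
      coefficient is strictly positive.\<close>
    show "0 < c 8 / 2 ^ 8" if "strict_abs_mono_seq D"
      using st[OF that] by (simp add: len) (simp add: nodes_def)
    fix s :: real assume "s \<in> {-2..<2}"
    then have s: "s / 2 \<in> {-1..<1}" by auto
    have "(\<Prod>a\<leftarrow>take j ?as. s / 2 - a) = newton_poly j s / 2 ^ j" if "j \<le> 15" for j
      using that unfolding take_map scale newton_poly_def by (simp add: len min_def)
    from this[of 15] this show "D 0 (s / 2) = (\<Sum>j<15. c j / 2 ^ j * newton_poly j s) + newton_poly 15 s * (R 0 (s / 2) / 2 ^ 15)"
      unfolding eq[OF s] by (simp add: len)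
  qed
qed

text \<open>For a nonempty spherical code this is the notion of a spherical m-design, expressed
  through zonal kernels.\<close>

definition moment_design :: "nat \<Rightarrow> (real ^ 4) set \<Rightarrow> bool" where
  "moment_design m C \<longleftrightarrow> (\<forall>k\<in>{1..m}. pair_sum (chebS k) C = 0)"

text \<open>Strict positivity in degrees 1 to 8 turns equality for \<open>newton_poly 8\<close> into
  the vanishing of the moments of these degrees.\<close>

lemma newton_8_pos: "\<forall>k\<in>set [0..<9]. zpos (newton_coeffs 8 ! k)" "length (newton_coeffs 8) = 9"
  by code_simp+

text \<open>The excess of C over the 600-cell is a sum of nonnegative terms, one per Newton
  polynomial and one for the remainder. Under equality all of them vanish: the term j = 8 yields the
  moments, the remainder yields the inner products.\<close>

lemma energy_bound:
  assumes D: "abs_mono_seq D" and C: "spherical_code C" and card: "card C = 120"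
  shows "offdiag_sum (\<lambda>s. D 0 (s / 2)) W120 \<le> offdiag_sum (\<lambda>s. D 0 (s / 2)) C"
    and "strict_abs_mono_seq D \<Longrightarrow> offdiag_sum (\<lambda>s. D 0 (s / 2)) C = offdiag_sum (\<lambda>s. D 0 (s / 2)) W120 \<Longrightarrow>
      moment_design 8 C \<and> (\<forall>x\<in>C. \<forall>y\<in>C. x \<noteq> y \<longrightarrow> 2 * (x \<bullet> y) \<in> inner_values)"
proof -
  from newton_energy[OF D] obtain c R where c: "\<And>j. 0 \<le> c j" and R: "\<And>s. s \<in> {-2..<2} \<Longrightarrow> 0 \<le> R s"
    and eq: "\<And>s. s \<in> {-2..<2} \<Longrightarrow> D 0 (s / 2) = (\<Sum>j<15. c j * newton_poly j s) + newton_poly 15 s * R s"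
    and c8: "strict_abs_mono_seq D \<Longrightarrow> 0 < c 8" and Rpos: "\<And>s. strict_abs_mono_seq D \<Longrightarrow> s \<in> {-2<..<2} \<Longrightarrow> 0 < R s"
    by blast
  let ?d = "\<lambda>s. D 0 (s / 2)" and ?r = "\<lambda>s. newton_poly 15 s * R s"
  have split: "offdiag_sum ?d B = (\<Sum>j<15. c j * offdiag_sum (newton_poly j) B) + offdiag_sum ?r B"
    if "spherical_code B" for B
    unfolding offdiag_sum_cmult[symmetric] offdiag_sum_sum[symmetric] offdiag_sum_add[symmetric]
    using eq by (rule offdiag_sum_cong[OF that])
  have rW: "offdiag_sum ?r W120 = 0"
    by (rule offdiag_sum_W120_vanishing) (use newton_poly_15_zero_iff in auto)
  have rC: "0 \<le> offdiag_sum ?r C"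
    by (rule offdiag_sum_nonneg[OF C]) (use R newton_poly_15_nonneg in auto)
  define \<delta> where "\<delta> = (\<lambda>j. c j * (offdiag_sum (newton_poly j) C - offdiag_sum (newton_poly j) W120))"
  have \<delta>: "0 \<le> \<delta> j" if "j < 15" for j
    unfolding \<delta>_def using newton_poly_bound[OF C card that] c by simp
  have diff: "offdiag_sum ?d C - offdiag_sum ?d W120 = (\<Sum>j<15. \<delta> j) + offdiag_sum ?r C"
    unfolding split[OF C] split[OF spherical_code_W120] rW \<delta>_def by (simp add: sum_subtractf algebra_simps)
  moreover have sum_nn: "0 \<le> (\<Sum>j<15. \<delta> j)" using \<delta> by (intro sum_nonneg) auto
  ultimately show "offdiag_sum ?d W120 \<le> offdiag_sum ?d C" using rC by linarith
  assume S: "strict_abs_mono_seq D" and E: "offdiag_sum ?d C = offdiag_sum ?d W120"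
  have "(\<Sum>j<15. \<delta> j) = 0" and r0: "offdiag_sum ?r C = 0" using diff E sum_nn rC by linarith+
  then have "\<delta> 8 = 0" using \<delta> by (subst (asm) sum_nonneg_eq_0_iff) auto
  then have e8: "offdiag_sum (newton_poly 8) C = offdiag_sum (newton_poly 8) W120" using c8[OF S] by (simp add: \<delta>_def)
  have card': "card C = card W120" by (simp add: card card_W120)
  have np: "newton_poly 8 = cheb_comb 0 (newton_coeffs 8)" by (rule ext) (rule newton_poly_cheb_comb)
  have pos: "0 < zval (newton_coeffs 8 ! k)" if "k \<in> {1..<9}" for k
    using newton_8_pos(1) that by (intro zpos_imp_pos) auto
  have "(\<Sum>k\<in>{1..<9}. zval (newton_coeffs 8 ! k) * pair_sum (chebS k) C) = 0"
    using lp_bound[OF C spherical_code_W120 card' W120_moments newton_feasible_low[of 8]] e8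
    unfolding np newton_8_pos(2) by simp
  then have "\<forall>k\<in>{1..<9}. zval (newton_coeffs 8 ! k) * pair_sum (chebS k) C = 0"
    by (subst (asm) sum_nonneg_eq_0_iff) (auto intro!: mult_nonneg_nonneg less_imp_le[OF pos] pair_sum_chebS_nonneg[OF C])
  then have "pair_sum (chebS k) C = 0" if "k \<in> {1..<9}" for k
    using pos[OF that] that by fastforce
  moreover have "{1..8} = {1..<9::nat}" by auto
  ultimately have "moment_design 8 C" unfolding moment_design_def by blast
  moreover have "2 * (x \<bullet> y) \<in> inner_values" if xy: "x \<in> C" "y \<in> C" "x \<noteq> y" for x y
  proof (rule ccontr)
    assume *: "2 * (x \<bullet> y) \<notin> inner_values"
    let ?O = "{(x, y). x \<in> C \<and> y \<in> C \<and> x \<noteq> y}"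
    have nn: "0 \<le> ?r (2 * (x \<bullet> y))" if "x \<in> C" "y \<in> C" "x \<noteq> y" for x y
      using spherical_code_inner_bounds[OF C that] R newton_poly_15_nonneg[of "2 * (x \<bullet> y)"] by auto
    have "(\<Sum>p\<in>?O. ?r (2 * (fst p \<bullet> snd p))) = 0"
      using r0 by (simp add: offdiag_sum_def case_prod_unfold)
    then have "\<forall>p\<in>?O. ?r (2 * (fst p \<bullet> snd p)) = 0"
      using nn offdiag_finite[OF spherical_code_finite[OF C]] by (subst (asm) sum_nonneg_eq_0_iff) auto
    then have "?r (2 * (x \<bullet> y)) = 0" using xy by auto
    moreover have "newton_poly 15 (2 * (x \<bullet> y)) \<noteq> 0" using * by (simp add: newton_poly_15_zero_iff)
    \<comment> \<open>R is known to be positive on (-2, 2) only; the endpoint -2 is itself an inner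
      product of the 600-cell and hence already excluded.\<close>
    moreover have "2 * (x \<bullet> y) \<noteq> -2" using * by (auto simp: inner_values_def)
    then have "0 < R (2 * (x \<bullet> y))" using spherical_code_inner_bounds[OF C xy] by (intro Rpos[OF S]) auto
    ultimately show False by simp
  qed
  ultimately show "moment_design 8 C \<and> (\<forall>x\<in>C. \<forall>y\<in>C. x \<noteq> y \<longrightarrow> 2 * (x \<bullet> y) \<in> inner_values)" by blast
qed

section \<open>Uniqueness\<close>

text \<open>What equality of energies retains of a code. The 600-cell has this property too, so the
  lemmas below apply to both codes that are compared.\<close>

definition cell_like :: "(real ^ 4) set \<Rightarrow> bool" where
  "cell_like C \<longleftrightarrow> spherical_code C \<and> card C = 120 \<and> moment_design 8 C \<and>
     (\<forall>x\<in>C. \<forall>y\<in>C. x \<noteq> y \<longrightarrow> 2 * (x \<bullet> y) \<in> inner_values)"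

definition nbhd :: "(real ^ 4) set \<Rightarrow> real ^ 4 \<Rightarrow> (real ^ 4) set" where
  "nbhd C x = {y \<in> C. 2 * (x \<bullet> y) = golden_ratio}"

lemma cell_like_norm: "cell_like C \<Longrightarrow> x \<in> C \<Longrightarrow> x \<bullet> x = 1"
  using spherical_code_norm by (auto simp: cell_like_def norm_eq_1)

lemma cell_like_finite: "cell_like C \<Longrightarrow> finite C"
  by (auto simp: cell_like_def spherical_code_def)

lemma inner_values_eq: "inner_values = {-2, - golden_ratio, -1, 1 - golden_ratio, 0, golden_ratio - 1, 1, golden_ratio}"
  by (simp add: inner_values_def zval_def)

text \<open>Quadrature for zonal polynomials of degree at most 8: around every unit vector the
  Chebyshev terms of positive degree sum to zero, which leaves the constant coefficient.\<close>

lemma cell_like_sum_cheb_comb: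
  assumes C: "cell_like C" and z: "norm z = 1" and cs: "cs \<noteq> []" "length cs \<le> 9"
  shows "(\<Sum>y\<in>C. cheb_comb 0 cs (2 * (z \<bullet> y))) = 120 * zval (hd cs)"
proof -
  have "(\<Sum>y\<in>C. cheb_comb 0 cs (2 * (z \<bullet> y))) = (\<Sum>k<length cs. zval (cs ! k) * (\<Sum>y\<in>C. chebS k (2 * (z \<bullet> y))))"
    unfolding cheb_comb_sum sum_distrib_left by (subst sum.swap) simp
  also have "\<dots> = (\<Sum>k<length cs. if k = 0 then 120 * zval (hd cs) else 0)"
  proof (rule sum.cong[OF refl])
    fix k assume k: "k \<in> {..<length cs}"
    show "zval (cs ! k) * (\<Sum>y\<in>C. chebS k (2 * (z \<bullet> y))) = (if k = 0 then 120 * zval (hd cs) else 0)"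
    proof (cases "k = 0")
      case True
      then show ?thesis using C cs by (simp add: cell_like_def hd_conv_nth)
    next
      case False
      then have "pair_sum (chebS k) C = 0" using C k cs by (auto simp: cell_like_def moment_design_def)
      then have "(\<Sum>y\<in>C. chebS k (2 * (z \<bullet> y))) = 0"
        using C z by (intro moment_zero_pointwise) (auto simp: cell_like_def)
      then show ?thesis using False by simp
    qed
  qed
  also have "\<dots> = 120 * zval (hd cs)" using cs by simp
  finally show ?thesis .
qed

lemma cell_like_power_sum:
  assumes C: "cell_like C" and k: "k \<le> 8"
  obtains m where "\<And>z. norm z = 1 \<Longrightarrow> (\<Sum>y\<in>C. (2 * (z \<bullet> y)) ^ k) = m"
proof -
  let ?cs = "fold zlinear_mul (replicate k (0, 0)) [(1, 0)]"
  have "\<forall>k\<in>set [0..<9]. fold zlinear_mul (replicate k (0, 0)) [(1, 0)] \<noteq> [] \<and> length (fold zlinear_mul (replicate k (0, 0)) [(1, 0)]) \<le> 9"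
    by code_simp
  moreover have "k \<in> set [0..<9]" using k by simp
  ultimately have cs: "?cs \<noteq> []" "length ?cs \<le> 9" by blast+
  have "s ^ k = cheb_comb 0 ?cs s" for s
    unfolding cheb_comb_fold_linear_mul by (simp add: prod_list_replicate)
  then show thesis using that cell_like_sum_cheb_comb[OF C _ cs] by presburger
qed

text \<open>P has degree 8 and vanishes at 2 and at every inner product but the golden ratio. Its
  sum over C therefore counts neighbours with weight P(phi), while quadrature gives 120 times its
  constant coefficient; \<open>val\<close> compares the two exactly.\<close>

lemma nbhd_card:
  assumes C: "cell_like C" and x: "x \<in> C"
  shows "card (nbhd C x) = 12"
proof -
  let ?as = "[(-2, 0), (0, -1), (-1, 0), (1, -1), (0, 0), (-1, 1), (1, 0), (2, 0)] :: zphi list"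
  let ?cs = "fold zlinear_mul ?as [(1, 0)]"
  define P where "P = (\<lambda>s. \<Prod>a\<leftarrow>?as. s - zval a)"
  have Peq: "P s = cheb_comb 0 ?cs s" for s
    unfolding cheb_comb_fold_linear_mul P_def by simp
  have cs: "?cs \<noteq> []" "length ?cs \<le> 9" by code_simp+
  have val: "zmul (12, 0) (foldr (\<lambda>a z. zmul (zadd (0, 1) (zmul (-1, 0) a)) z) ?as (1, 0)) = zmul (120, 0) (hd ?cs)"
    by code_simp
  have "zval (foldr (\<lambda>a z. zmul (zadd (0, 1) (zmul (-1, 0) a)) z) as (1, 0)) = (\<Prod>a\<leftarrow>as. golden_ratio - zval a)" for as
    by (induction as) simp_all
  from this[of ?as] have Pphi: "12 * P golden_ratio = 120 * zval (hd ?cs)"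
    using arg_cong[OF val, of zval] by (simp add: P_def del: foldr.simps fold.simps list.map prod_list.Cons)
  have Pphi0: "P golden_ratio \<noteq> 0"
    using golden_ratio_bounds by (simp add: P_def zval_def)
  have "(\<Sum>y\<in>C. P (2 * (x \<bullet> y))) = 120 * zval (hd ?cs)"
    unfolding Peq using C x spherical_code_norm cell_like_def by (intro cell_like_sum_cheb_comb[OF C _ cs]) blast
  moreover have "(\<Sum>y\<in>C. P (2 * (x \<bullet> y))) = (\<Sum>y\<in>nbhd C x. P golden_ratio)"
  proof -
    have "P (2 * (x \<bullet> y)) = 0" if "y \<in> C - nbhd C x" for y
    proof (cases "x = y")
      case True
      then show ?thesis using cell_like_norm[OF C x] by (simp add: P_def)
    next
      case False
      then have "2 * (x \<bullet> y) \<in> inner_values - {golden_ratio}" using C x that by (auto simp: cell_like_def nbhd_def)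
      then show ?thesis unfolding inner_values_eq by (auto simp: P_def zval_def)
    qed
    then have "(\<Sum>y\<in>C. P (2 * (x \<bullet> y))) = (\<Sum>y\<in>nbhd C x. P (2 * (x \<bullet> y)))"
      using cell_like_finite[OF C] by (intro sum.mono_neutral_right) (auto simp: nbhd_def)
    also have "\<dots> = (\<Sum>y\<in>nbhd C x. P golden_ratio)" by (intro sum.cong) (auto simp: nbhd_def)
    finally show ?thesis .
  qed
  ultimately have "real (card (nbhd C x)) * P golden_ratio = 12 * P golden_ratio" using Pphi by simp
  then have "real (card (nbhd C x)) = 12" using Pphi0 by simp
  then show ?thesis by linarith
qed

text \<open>Power sums are constant on the sphere; differentiating along a great circle kills the odd part.\<close>
lemma cell_like_tangent_power:
  assumes C: "cell_like C" and x: "norm x = 1" and v: "x \<bullet> v = 0" and k: "k \<le> 7"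
  shows "(\<Sum>y\<in>C. (2 * (x \<bullet> y)) ^ k * (v \<bullet> y)) = 0"
proof (cases "v = 0")
  case False
  define u where "u = v /\<^sub>R norm v"
  have u: "u \<bullet> u = 1" "x \<bullet> u = 0" and vu: "v = norm v *\<^sub>R u"
    using False v by (simp_all add: u_def dot_square_norm power2_eq_square)
  obtain m where m: "\<And>z. norm z = 1 \<Longrightarrow> (\<Sum>y\<in>C. (2 * (z \<bullet> y)) ^ Suc k) = m"
    using cell_like_power_sum[OF C, of "Suc k"] k by auto
  let ?G = "\<lambda>t. \<Sum>y\<in>C. (2 * ((cos t *\<^sub>R x + sin t *\<^sub>R u) \<bullet> y)) ^ Suc k"
  have "?G t = m" for t
  proof (rule m)
    have "(cos t *\<^sub>R x + sin t *\<^sub>R u) \<bullet> (cos t *\<^sub>R x + sin t *\<^sub>R u) = (cos t)\<^sup>2 + (sin t)\<^sup>2"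
      using u x by (simp add: norm_eq_1 inner_add inner_commute power2_eq_square)
    then show "norm (cos t *\<^sub>R x + sin t *\<^sub>R u) = 1" by (simp add: norm_eq_1)
  qed
  then have "?G = (\<lambda>t. m)" by (rule ext)
  then have 1: "(?G has_real_derivative 0) (at 0)" by simp
  have 2: "(?G has_real_derivative (\<Sum>y\<in>C. real (Suc k) * (2 * (x \<bullet> y)) ^ k * (2 * (u \<bullet> y)))) (at 0)"
  proof (rule DERIV_sum)
    fix y
    have "((\<lambda>t. 2 * (cos t * (x \<bullet> y) + sin t * (u \<bullet> y))) has_real_derivative 2 * (u \<bullet> y)) (at 0)"
      by (auto intro!: derivative_eq_intros)
    from DERIV_power[OF this, of "Suc k"]
    show "((\<lambda>t. (2 * ((cos t *\<^sub>R x + sin t *\<^sub>R u) \<bullet> y)) ^ Suc k) has_real_derivative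
      real (Suc k) * (2 * (x \<bullet> y)) ^ k * (2 * (u \<bullet> y))) (at 0)"
      by (simp add: inner_add_left mult_ac del: power_Suc)
  qed
  have "(\<Sum>y\<in>C. real (Suc k) * (2 * (x \<bullet> y)) ^ k * (2 * (u \<bullet> y))) = 0"
    by (rule DERIV_unique[OF 2 1])
  moreover have "(\<Sum>y\<in>C. real (Suc k) * (2 * (x \<bullet> y)) ^ k * (2 * (u \<bullet> y)))
      = (real (Suc k) * 2) * (\<Sum>y\<in>C. (2 * (x \<bullet> y)) ^ k * (u \<bullet> y))"
    unfolding sum_distrib_left by (intro sum.cong refl) (simp add: mult_ac del: of_nat_Suc)
  ultimately have "(\<Sum>y\<in>C. (2 * (x \<bullet> y)) ^ k * (u \<bullet> y)) = 0" by simp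
  moreover have "(\<Sum>y\<in>C. (2 * (x \<bullet> y)) ^ k * (v \<bullet> y)) = norm v * (\<Sum>y\<in>C. (2 * (x \<bullet> y)) ^ k * (u \<bullet> y))"
    by (subst vu) (simp add: sum_distrib_left mult_ac)
  ultimately show ?thesis by simp
qed simp

lemma cell_like_tangent_prod:
  assumes C: "cell_like C" and x: "norm x = 1" and v: "x \<bullet> v = 0" and k: "k + length as \<le> 7"
  shows "(\<Sum>y\<in>C. (2 * (x \<bullet> y)) ^ k * (\<Prod>a\<leftarrow>as. 2 * (x \<bullet> y) - a) * (v \<bullet> y)) = 0"
  using k
proof (induction as arbitrary: k)
  case Nil
  then show ?case using cell_like_tangent_power[OF C x v] by simp
next
  case (Cons a as)
  have "(\<Sum>y\<in>C. (2 * (x \<bullet> y)) ^ k * (\<Prod>a\<leftarrow>a # as. 2 * (x \<bullet> y) - a) * (v \<bullet> y))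
     = (\<Sum>y\<in>C. (2 * (x \<bullet> y)) ^ Suc k * (\<Prod>a\<leftarrow>as. 2 * (x \<bullet> y) - a) * (v \<bullet> y))
      - a * (\<Sum>y\<in>C. (2 * (x \<bullet> y)) ^ k * (\<Prod>a\<leftarrow>as. 2 * (x \<bullet> y) - a) * (v \<bullet> y))"
    unfolding sum_distrib_left sum_subtractf[symmetric] by (intro sum.cong refl) (simp add: algebra_simps)
  then show ?case using Cons.IH[of k] Cons.IH[of "Suc k"] Cons.prems by simp
qed

section \<open>The icosahedron of neighbours of a point\<close>

lemma unit_inner_eq_imp_eq: 
  fixes x y :: "real ^ 4"
  assumes "x \<bullet> x = 1" "y \<bullet> y = 1" "x \<bullet> y = 1" shows "x = y"
proof -
  have "(x - y) \<bullet> (x - y) = 0" using assms by (simp add: inner_diff inner_commute)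
  then show ?thesis by simp
qed

text \<open>P isolates the neighbours with degree 6 only, because the terms y = x and y = -x already
  vanish by orthogonality to v. The conclusion says that the sum of the neighbours is a multiple of
  x.\<close>

lemma nbhd_tangent_sum:
  assumes C: "cell_like C" and x: "x \<in> C" and v: "x \<bullet> v = 0"
  shows "(\<Sum>y\<in>nbhd C x. v \<bullet> y) = 0"
proof -
  let ?as = "[- golden_ratio, -1, 1 - golden_ratio, 0, golden_ratio - 1, 1]"
  define P where "P = (\<lambda>s. \<Prod>a\<leftarrow>?as. s - a)"
  have nx: "norm x = 1" using cell_like_norm[OF C x] by (simp add: norm_eq_1)
  have "(\<Sum>y\<in>C. P (2 * (x \<bullet> y)) * (v \<bullet> y)) = 0"
    using cell_like_tangent_prod[OF C nx v, of 0 ?as] by (simp add: P_def)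
  moreover have "(\<Sum>y\<in>C. P (2 * (x \<bullet> y)) * (v \<bullet> y)) = (\<Sum>y\<in>nbhd C x. P (2 * (x \<bullet> y)) * (v \<bullet> y))"
  proof (rule sum.mono_neutral_right)
    show "\<forall>y\<in>C - nbhd C x. P (2 * (x \<bullet> y)) * (v \<bullet> y) = 0"
    proof
      fix y assume y: "y \<in> C - nbhd C x"
      consider "x = y" | "2 * (x \<bullet> y) = -2" | "2 * (x \<bullet> y) \<in> inner_values - {golden_ratio, -2}"
        using C x y by (auto simp: cell_like_def nbhd_def)
      then show "P (2 * (x \<bullet> y)) * (v \<bullet> y) = 0"
      proof cases
        case 1
        then show ?thesis using v by (simp add: inner_commute)
      next
        case 2
        have "x = - y" by (rule unit_inner_eq_imp_eq) (use cell_like_norm[OF C] x y 2 in auto)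
        then show ?thesis using v by (simp add: inner_commute)
      next
        case 3
        then show ?thesis unfolding inner_values_eq by (auto simp: P_def)
      qed
    qed
  qed (use cell_like_finite[OF C] in \<open>auto simp: nbhd_def\<close>)
  moreover have "\<dots> = P golden_ratio * (\<Sum>y\<in>nbhd C x. v \<bullet> y)"
    unfolding sum_distrib_left by (intro sum.cong refl) (auto simp: nbhd_def)
  moreover have "P golden_ratio \<noteq> 0" using golden_ratio_bounds by (simp add: P_def)
  ultimately show ?thesis by simp
qed

lemma golden_ratio_lin_indep:
  assumes "of_int a + of_int b * golden_ratio = of_int c + of_int d * golden_ratio"
  shows "a = c \<and> b = d"
  using assms zval_inj[of "(a, b)" "(c, d)"] by (simp add: zval_def)

text \<open>The squared norm of w + y - phi x is 2 (w \<bullet> y) - (phi - 1). This bounds the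
  inner products of neighbours from below, and equality makes y the antipode phi x - w of w in the
  icosahedron.\<close>

lemma nbhd_inner_cases:
  assumes C: "cell_like C" and x: "x \<in> C" and w: "w \<in> nbhd C x" and y: "y \<in> nbhd C x"
  shows "2 * (w \<bullet> y) \<in> {2, golden_ratio, 1, golden_ratio - 1}"
    and "2 * (w \<bullet> y) = 2 \<longleftrightarrow> y = w"
    and "2 * (w \<bullet> y) = golden_ratio - 1 \<longleftrightarrow> y = golden_ratio *\<^sub>R x - w"
proof -
  have xx: "x \<bullet> x = 1" "w \<bullet> w = 1" "y \<bullet> y = 1" using cell_like_norm[OF C] x w y by (auto simp: nbhd_def)
  have xw: "x \<bullet> w = golden_ratio / 2" "x \<bullet> y = golden_ratio / 2" using w y by (auto simp: nbhd_def)
  have "(w + y - golden_ratio *\<^sub>R x) \<bullet> (w + y - golden_ratio *\<^sub>R x) =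
      2 + 2 * (w \<bullet> y) - golden_ratio * golden_ratio"
    using xx xw by (simp add: inner_add inner_diff inner_commute algebra_simps)
  then have sq: "(w + y - golden_ratio *\<^sub>R x) \<bullet> (w + y - golden_ratio *\<^sub>R x) = 2 * (w \<bullet> y) - (golden_ratio - 1)"
    unfolding golden_ratio_square by simp
  then have ge: "golden_ratio - 1 \<le> 2 * (w \<bullet> y)" using inner_ge_zero[of "w + y - golden_ratio *\<^sub>R x"] by linarith
  show e: "2 * (w \<bullet> y) = 2 \<longleftrightarrow> y = w"
    using unit_inner_eq_imp_eq[of w y] xx by auto
  have "w = y \<or> 2 * (w \<bullet> y) \<in> inner_values" using C w y by (auto simp: cell_like_def nbhd_def)
  then show "2 * (w \<bullet> y) \<in> {2, golden_ratio, 1, golden_ratio - 1}"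
    using ge golden_ratio_bounds e unfolding inner_values_eq by auto
  have "2 * (w \<bullet> y) = golden_ratio - 1 \<longleftrightarrow> w + y - golden_ratio *\<^sub>R x = 0"
    using sq by (metis diff_eq_eq add_0 inner_eq_zero_iff)
  then show "2 * (w \<bullet> y) = golden_ratio - 1 \<longleftrightarrow> y = golden_ratio *\<^sub>R x - w"
    by (simp add: algebra_simps eq_diff_eq)
qed

text \<open>The tangent sum gives 2 + n1 phi + n2 + n3 (phi - 1) = 6 + 6 phi for the numbers n1, n2,
  n3 of neighbours at the three smaller inner products. Since 1 and phi are independent over the
  integers, adding 1 + n1 + n2 + n3 = 12 leaves only n1 = n2 = 5 and n3 = 1.\<close>

lemma nbhd_structure:
  assumes C: "cell_like C" and x: "x \<in> C" and w: "w \<in> nbhd C x"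
  shows "golden_ratio *\<^sub>R x - w \<in> nbhd C x" and "card {y \<in> nbhd C x. 2 * (w \<bullet> y) = golden_ratio} = 5"
proof -
  let ?N = "\<lambda>r. {y \<in> nbhd C x. 2 * (w \<bullet> y) = r}"
  have fin: "finite (nbhd C x)" using cell_like_finite[OF C] by (auto simp: nbhd_def)
  \<comment> \<open>Twice the component of w orthogonal to x.\<close>
  define v where "v = 2 *\<^sub>R w - golden_ratio *\<^sub>R x"
  have xx: "x \<bullet> x = 1" "w \<bullet> w = 1" using cell_like_norm[OF C] x w by (auto simp: nbhd_def)
  have "x \<bullet> v = 0" using w xx by (simp add: v_def inner_diff nbhd_def)
  then have "(\<Sum>y\<in>nbhd C x. v \<bullet> y) = 0" by (rule nbhd_tangent_sum[OF C x])
  moreover have "(\<Sum>y\<in>nbhd C x. v \<bullet> y) = (\<Sum>y\<in>nbhd C x. 2 * (w \<bullet> y) - golden_ratio * golden_ratio / 2)"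
    by (intro sum.cong refl) (simp add: v_def inner_diff nbhd_def)
  ultimately have s: "(\<Sum>y\<in>nbhd C x. 2 * (w \<bullet> y)) = 6 * golden_ratio + 6"
    by (simp add: sum_subtractf nbhd_card[OF C x] golden_ratio_square)
  have vals: "nbhd C x = ?N 2 \<union> (?N golden_ratio \<union> (?N 1 \<union> ?N (golden_ratio - 1)))"
    using nbhd_inner_cases(1)[OF C x w] by auto
  have split: "(\<Sum>y\<in>nbhd C x. f (2 * (w \<bullet> y))) = card (?N 2) * f 2 + card (?N golden_ratio) * f golden_ratio
     + card (?N 1) * f 1 + card (?N (golden_ratio - 1)) * f (golden_ratio - 1)" for f :: "real \<Rightarrow> real"
  proof -
    have "(\<Sum>y\<in>nbhd C x. f (2 * (w \<bullet> y))) = sum (\<lambda>y. f (2 * (w \<bullet> y))) (?N 2) + (sum (\<lambda>y. f (2 * (w \<bullet> y))) (?N golden_ratio)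
       + (sum (\<lambda>y. f (2 * (w \<bullet> y))) (?N 1) + sum (\<lambda>y. f (2 * (w \<bullet> y))) (?N (golden_ratio - 1))))"
      using golden_ratio_bounds fin
      by (subst vals, subst sum.union_disjoint, simp, simp, force, subst sum.union_disjoint, simp, simp, force,
          subst sum.union_disjoint, auto)
    moreover have "sum (\<lambda>y. f (2 * (w \<bullet> y))) (?N r) = card (?N r) * f r" for r
    proof -
      have "sum (\<lambda>y. f (2 * (w \<bullet> y))) (?N r) = sum (\<lambda>y. f r) (?N r)" by (intro sum.cong) auto
      then show ?thesis by simp
    qed
    ultimately show ?thesis by simp
  qed
  have "?N 2 = {w}" using nbhd_inner_cases(2)[OF C x w] w by auto
  then have c2: "card (?N 2) = 1" by simp
  define n1 n2 n3 where "n1 = card (?N golden_ratio)" and "n2 = card (?N 1)" and "n3 = card (?N (golden_ratio - 1))"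
  have "real (1 + n1 + n2 + n3) = 12"
    using split[of "\<lambda>_. 1"] unfolding c2 n1_def[symmetric] n2_def[symmetric] n3_def[symmetric]
    by (simp add: nbhd_card[OF C x])
  then have t: "1 + n1 + n2 + n3 = 12" by linarith
  have "of_int (2 + int n2 - int n3) + of_int (int n1 + int n3) * golden_ratio = of_int 6 + of_int 6 * golden_ratio"
    using split[of "\<lambda>r. r"] unfolding s c2 n1_def[symmetric] n2_def[symmetric] n3_def[symmetric]
    by (simp add: algebra_simps)
  from golden_ratio_lin_indep[OF this] t have "n3 = 1" "n1 = 5" by linarith+
  then show "card (?N golden_ratio) = 5" by (simp add: n1_def)
  from \<open>n3 = 1\<close> obtain y where "y \<in> ?N (golden_ratio - 1)" unfolding n3_def by (metis card_1_singletonE singletonI)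
  then show "golden_ratio *\<^sub>R x - w \<in> nbhd C x" using nbhd_inner_cases(3)[OF C x w] by auto
qed

lemma tetrahedron_exists:
  assumes C: "cell_like C" and x: "x \<in> C"
  obtains y z t where "y \<in> nbhd C x" "z \<in> nbhd C x" "t \<in> nbhd C x" "z \<in> nbhd C y" "t \<in> nbhd C y" "t \<in> nbhd C z"
proof -
  have "nbhd C x \<noteq> {}" using nbhd_card[OF C x] by auto
  then obtain y where y: "y \<in> nbhd C x" by blast
  define B where "B = {b \<in> nbhd C x. 2 * (y \<bullet> b) = golden_ratio}"
  have cB: "card B = 5" using nbhd_structure(2)[OF C x y] by (simp add: B_def)
  have "\<exists>b\<in>B. \<exists>b'\<in>B. 2 * (b \<bullet> b') = golden_ratio"
  proof (rule ccontr)
    assume no: "\<not> ?thesis"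
    have pair: "b \<bullet> b' = 1 / 2" if b: "b \<in> B" "b' \<in> B" "b \<noteq> b'" for b b'
    proof -
      have bn: "b \<in> nbhd C x" "b' \<in> nbhd C x" using b by (auto simp: B_def)
      note cs = nbhd_inner_cases[OF C x bn]
      \<comment> \<open>y has inner product phi / 2 with b, hence 1/2 with the antipode of b, which
        therefore is not in B.\<close>
      have "2 * (b \<bullet> b') \<noteq> golden_ratio - 1"
      proof
        assume "2 * (b \<bullet> b') = golden_ratio - 1"
        then have "b' = golden_ratio *\<^sub>R x - b" using cs(3) by blast
        then have e: "y \<bullet> b' = golden_ratio * (x \<bullet> y) - y \<bullet> b"
          by (simp add: inner_diff_right inner_commute)
        have ip: "x \<bullet> y = golden_ratio / 2" "y \<bullet> b = golden_ratio / 2" "y \<bullet> b' = golden_ratio / 2"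
          using b y by (auto simp: B_def nbhd_def)
        from e have "golden_ratio / 2 = golden_ratio * (golden_ratio / 2) - golden_ratio / 2" unfolding ip .
        then show False using golden_ratio_square golden_ratio_bounds by (simp add: field_simps)
      qed
      then show ?thesis using cs no b by auto
    qed
    obtain b1 b2 b3 where b: "b1 \<in> B" "b2 \<in> B" "b3 \<in> B" "b1 \<noteq> b2" "b1 \<noteq> b3" "b2 \<noteq> b3"
    proof -
      have "3 \<le> card B" using cB by simp
      then obtain T where "T \<subseteq> B" "card T = 3" by (meson obtain_subset_with_card_n)
      then show thesis using that by (auto simp: card_3_iff)
    qed
    \<comment> \<open>With all mutual inner products of the b's equal to 1/2, its squared length
      would be 6 - 4 phi < 0.\<close>
    let ?V = "b1 + b2 + b3 - y - golden_ratio *\<^sub>R x"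
    have self: "u \<bullet> u = 1" if "u \<in> {x, y, b1, b2, b3}" for u
      using cell_like_norm[OF C] that x y b by (auto simp: B_def nbhd_def)
    have ip: "x \<bullet> y = golden_ratio / 2" "x \<bullet> b1 = golden_ratio / 2" "x \<bullet> b2 = golden_ratio / 2" "x \<bullet> b3 = golden_ratio / 2"
      "y \<bullet> b1 = golden_ratio / 2" "y \<bullet> b2 = golden_ratio / 2" "y \<bullet> b3 = golden_ratio / 2"
      using y b by (auto simp: B_def nbhd_def)
    have "?V \<bullet> ?V = 7 - 3 * golden_ratio - golden_ratio * golden_ratio"
      using self ip pair[OF b(1,2,4)] pair[OF b(1,3,5)] pair[OF b(2,3,6)]
        inner_commute[of y x] inner_commute[of b1 x] inner_commute[of b2 x] inner_commute[of b3 x]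
        inner_commute[of b1 y] inner_commute[of b2 y] inner_commute[of b3 y]
        inner_commute[of b2 b1] inner_commute[of b3 b1] inner_commute[of b3 b2]
      by (simp add: inner_add_left inner_add_right inner_diff_left inner_diff_right algebra_simps)
    moreover have "0 \<le> ?V \<bullet> ?V" by (rule inner_ge_zero)
    ultimately show False using golden_ratio_bounds by (simp add: golden_ratio_square)
  qed
  then obtain b b' where "b \<in> B" "b' \<in> B" "2 * (b \<bullet> b') = golden_ratio" by blast
  then show thesis using that[of y b b'] y by (auto simp: B_def nbhd_def)
qed

section \<open>Tetrahedral frames\<close>

definition golden_frame :: "real ^ 4 \<Rightarrow> real ^ 4 \<Rightarrow> real ^ 4 \<Rightarrow> real ^ 4 \<Rightarrow> bool" where
  "golden_frame x y z t \<longleftrightarrow> x \<bullet> x = 1 \<and> y \<bullet> y = 1 \<and> z \<bullet> z = 1 \<and> t \<bullet> t = 1 \<and>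
     2 * (x \<bullet> y) = golden_ratio \<and> 2 * (x \<bullet> z) = golden_ratio \<and> 2 * (x \<bullet> t) = golden_ratio \<and>
     2 * (y \<bullet> z) = golden_ratio \<and> 2 * (y \<bullet> t) = golden_ratio \<and> 2 * (z \<bullet> t) = golden_ratio"

lemma golden_frame_inner:
  assumes "golden_frame x y z t" "u \<in> {x, y, z, t}" "v \<in> {x, y, z, t}"
  shows "u \<bullet> v = (if u = v then 1 else golden_ratio / 2)"
proof -
  have "u \<bullet> v = 1 \<or> u \<bullet> v = golden_ratio / 2" "u \<bullet> u = 1" "v \<bullet> v = 1" and ne: "u \<bullet> v = 1 \<or> u \<noteq> v"
    using assms inner_commute[of y x] inner_commute[of z x] inner_commute[of t x]
        inner_commute[of z y] inner_commute[of t y] inner_commute[of t z]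
    by (auto simp: golden_frame_def)
  then show ?thesis using unit_inner_eq_imp_eq[of u v] golden_ratio_bounds by auto
qed

lemma golden_frame_distinct:
  assumes "golden_frame x y z t" shows "x \<noteq> y" "x \<noteq> z" "x \<noteq> t" "y \<noteq> z" "y \<noteq> t" "z \<noteq> t"
  using assms golden_ratio_bounds by (auto simp: golden_frame_def)

text \<open>The Gram matrix is (1 - phi/2) I + (phi/2) J, J the all-ones matrix, with eigenvalues 1
  - phi/2 and 1 + 3 phi/2, both nonzero. Accordingly the sum S of the coefficients is shown to
  vanish before the single coefficients.\<close>

lemma golden_frame_independent:
  assumes F: "golden_frame x y z t" shows "independent {x, y, z, t}"
proof (rule independent_if_scalars_zero)
  let ?B = "{x, y, z, t}"
  fix f u assume 0: "(\<Sum>v\<in>?B. f v *\<^sub>R v) = 0" and u: "u \<in> ?B"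
  define S where "S = (\<Sum>v\<in>?B. f v)"
  have val: "(1 - golden_ratio / 2) * f w = - (golden_ratio / 2 * S)" if w: "w \<in> ?B" for w
  proof -
    have "0 = (\<Sum>v\<in>?B. f v *\<^sub>R v) \<bullet> w" using 0 by simp
    also have "\<dots> = (\<Sum>v\<in>?B. f v * (v \<bullet> w))" by (simp only: inner_sum_left inner_scaleR_left)
    also have "\<dots> = (\<Sum>v\<in>?B. golden_ratio / 2 * f v + (if v = w then (1 - golden_ratio / 2) * f v else 0))"
      by (intro sum.cong refl) (auto simp: golden_frame_inner[OF F _ w] algebra_simps)
    also have "\<dots> = golden_ratio / 2 * S + (1 - golden_ratio / 2) * f w"
    proof -
      have "(\<Sum>v\<in>?B. golden_ratio / 2 * f v) = golden_ratio / 2 * S" by (simp only: S_def sum_distrib_left)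
      moreover have "(\<Sum>v\<in>?B. if v = w then (1 - golden_ratio / 2) * f v else 0) = (1 - golden_ratio / 2) * f w"
        using w by (subst sum.delta) auto
      ultimately show ?thesis unfolding sum.distrib by simp
    qed
    finally show ?thesis by simp
  qed
  have "(1 - golden_ratio / 2) * S = (\<Sum>w\<in>?B. (1 - golden_ratio / 2) * f w)"
    by (simp only: S_def sum_distrib_left)
  also have "\<dots> = (\<Sum>w\<in>?B. - (golden_ratio / 2 * S))"
    by (intro sum.cong refl val)
  also have "\<dots> = - (4 * (golden_ratio / 2 * S))" using golden_frame_distinct[OF F] by simp
  finally have "(1 + 3 * golden_ratio / 2) * S = 0" by (simp add: algebra_simps)
  then have "S = 0" using golden_ratio_bounds by simp
  then show "f u = 0" using val[OF u] golden_ratio_bounds by simp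
qed simp

lemma golden_frame_span:
  assumes F: "golden_frame x y z t" shows "span {x, y, z, t} = UNIV"
proof -
  have "card {x, y, z, t} = 4" using golden_frame_distinct[OF F] by simp
  then have "UNIV \<subseteq> span {x, y, z, t}"
    by (intro card_ge_dim_independent golden_frame_independent[OF F]) (auto simp: dim_UNIV)
  then show ?thesis by blast
qed

lemma golden_frame_eqI:
  assumes F: "golden_frame x y z t" and "u \<bullet> x = v \<bullet> x" "u \<bullet> y = v \<bullet> y" "u \<bullet> z = v \<bullet> z" "u \<bullet> t = v \<bullet> t"
  shows "u = v"
proof -
  have "(u - v) \<bullet> w = 0" if "w \<in> span {x, y, z, t}" for w
    using that by (induction rule: span_induct_alt) (use assms in \<open>auto simp: inner_add_right inner_diff_left\<close>)
  then have "(u - v) \<bullet> (u - v) = 0" using golden_frame_span[OF F] by blast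
  then show ?thesis by simp
qed

lemma golden_frame_isometry:
  assumes F: "golden_frame x y z t" and F': "golden_frame x' y' z' t'"
  obtains f where "orthogonal_transformation f" "f x = x'" "f y = y'" "f z = z'" "f t = t'"
proof -
  define g where "g = (\<lambda>u. if u = x then x' else if u = y then y' else if u = z then z' else t')"
  have g: "g x = x'" "g y = y'" "g z = z'" "g t = t'"
    using golden_frame_distinct[OF F] by (auto simp: g_def)
  obtain f where f: "linear f" "\<And>u. u \<in> {x, y, z, t} \<Longrightarrow> f u = g u"
    using linear_independent_extend[OF golden_frame_independent[OF F], of g] by blast
  have fv: "f x = x'" "f y = y'" "f z = z'" "f t = t'" using f(2) g by auto
  have base: "f u \<bullet> f v = u \<bullet> v" if "u \<in> {x, y, z, t}" "v \<in> {x, y, z, t}" for u v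
    using that fv golden_frame_distinct[OF F] golden_frame_distinct[OF F']
      golden_frame_inner[OF F that] golden_frame_inner[OF F', of "f u" "f v"] by auto
  have 1: "f u \<bullet> f v = u \<bullet> v" if u: "u \<in> {x, y, z, t}" and v: "v \<in> span {x, y, z, t}" for u v
    using v by (induction rule: span_induct_alt)
      (use base[OF u] f(1) in \<open>simp_all add: linear_0 linear_add linear_scale inner_add_right\<close>)
  have 2: "f u \<bullet> f v = u \<bullet> v" if u: "u \<in> span {x, y, z, t}" and v: "v \<in> span {x, y, z, t}" for u v
    using u by (induction rule: span_induct_alt)
      (use 1[OF _ v] f(1) in \<open>simp_all add: linear_0 linear_add linear_scale inner_add_left\<close>)
  have "orthogonal_transformation f"
    unfolding orthogonal_transformation_def using f(1) 2 golden_frame_span[OF F] by blast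
  then show thesis using that fv by blast
qed

text \<open>Pairing with the frame forces (2 + 3 phi) u = phi (x + y + z + t); then u \<bullet> u =
  1 would read 2 + 3 phi = 2 phi^2 = 2 + 2 phi.\<close>

lemma golden_frame_maximal:
  assumes F: "golden_frame x y z t" and u: "u \<bullet> u = 1"
  shows "\<not> (2 * (u \<bullet> x) = golden_ratio \<and> 2 * (u \<bullet> y) = golden_ratio \<and> 2 * (u \<bullet> z) = golden_ratio \<and> 2 * (u \<bullet> t) = golden_ratio)"
proof
  assume a: "2 * (u \<bullet> x) = golden_ratio \<and> 2 * (u \<bullet> y) = golden_ratio \<and> 2 * (u \<bullet> z) = golden_ratio \<and> 2 * (u \<bullet> t) = golden_ratio"
  have eq: "(2 + 3 * golden_ratio) *\<^sub>R u = golden_ratio *\<^sub>R (x + y + z + t)"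
  proof (rule golden_frame_eqI[OF F])
    have ip: "u \<bullet> x = golden_ratio / 2" "u \<bullet> y = golden_ratio / 2" "u \<bullet> z = golden_ratio / 2" "u \<bullet> t = golden_ratio / 2"
      using a by simp_all
    note ip' = golden_frame_inner[OF F, simplified] golden_frame_distinct[OF F] golden_frame_distinct[OF F, symmetric]
    show "((2 + 3 * golden_ratio) *\<^sub>R u) \<bullet> x = (golden_ratio *\<^sub>R (x + y + z + t)) \<bullet> x"
      "((2 + 3 * golden_ratio) *\<^sub>R u) \<bullet> y = (golden_ratio *\<^sub>R (x + y + z + t)) \<bullet> y"
      "((2 + 3 * golden_ratio) *\<^sub>R u) \<bullet> z = (golden_ratio *\<^sub>R (x + y + z + t)) \<bullet> z"
      "((2 + 3 * golden_ratio) *\<^sub>R u) \<bullet> t = (golden_ratio *\<^sub>R (x + y + z + t)) \<bullet> t"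
      unfolding inner_scaleR_left inner_add_left ip by (simp_all add: ip' algebra_simps)
  qed
  have "(2 + 3 * golden_ratio) * (u \<bullet> u) = golden_ratio * ((x + y + z + t) \<bullet> u)"
    using arg_cong[OF eq, of "\<lambda>w. w \<bullet> u"] by simp
  also have "\<dots> = 2 * (golden_ratio * golden_ratio)"
  proof -
    have ip: "x \<bullet> u = golden_ratio / 2" "y \<bullet> u = golden_ratio / 2" "z \<bullet> u = golden_ratio / 2" "t \<bullet> u = golden_ratio / 2"
      using a by (simp_all add: inner_commute[of u])
    show ?thesis unfolding inner_add_left ip by simp
  qed
  finally show False using u golden_ratio_bounds by (simp add: golden_ratio_square)
qed

text \<open>The inner products (doubled) of the twelve neighbours of \<open>x\<close> with the other vertices of a
  tetrahedron at \<open>x\<close>: the vertices, their antipodes in the icosahedron, and the six remaining vertices.\<close>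
definition frame_patterns :: "(real \<times> real \<times> real) list" where
  "frame_patterns = (let p = golden_ratio in
     [(2, p, p), (p, 2, p), (p, p, 2), (p - 1, 1, 1), (1, p - 1, 1), (1, 1, p - 1),
      (p, 1, 1), (1, p, 1), (1, 1, p), (p, p, 1), (p, 1, p), (1, p, p)])"

text \<open>The right-hand side depends on the frame alone, so codes sharing the frame share these
  neighbours. Inner products with a frame determine a point, so that set has at most 12 elements,
  and containing the 12 neighbours it equals them.\<close>

lemma nbhd_eq_patterns:
  assumes C: "cell_like C" and x: "x \<in> C" and nb: "y \<in> nbhd C x" "z \<in> nbhd C x" "t \<in> nbhd C x"
    and F: "golden_frame x y z t"
  shows "nbhd C x = {u. 2 * (u \<bullet> x) = golden_ratio \<and> (2 * (y \<bullet> u), 2 * (z \<bullet> u), 2 * (t \<bullet> u)) \<in> set frame_patterns}"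
    (is "_ = ?S")
proof (rule card_subset_eq)
  let ?h = "\<lambda>u. (2 * (y \<bullet> u), 2 * (z \<bullet> u), 2 * (t \<bullet> u))"
  have inj: "inj_on ?h ?S"
    by (rule inj_onI, rule golden_frame_eqI[OF F]) (auto simp: inner_commute)
  have im: "?h ` ?S \<subseteq> set frame_patterns" by auto
  show fin: "finite ?S" using inj_on_finite[OF inj im] by simp
  have le: "card ?S \<le> 12"
  proof -
    have "card ?S \<le> card (set frame_patterns)" using inj im by (rule card_inj_on_le) simp
    also have "\<dots> \<le> length frame_patterns" by (rule card_length)
    also have "\<dots> = 12" by (simp add: frame_patterns_def Let_def)
    finally show ?thesis .
  qed
  show sub: "nbhd C x \<subseteq> ?S"
  proof
    fix u assume u: "u \<in> nbhd C x"
    have uu: "u \<bullet> u = 1" using cell_like_norm[OF C] u by (auto simp: nbhd_def)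
    have ux: "2 * (u \<bullet> x) = golden_ratio" using u by (simp add: nbhd_def inner_commute)
    note cy = nbhd_inner_cases[OF C x nb(1) u] and cz = nbhd_inner_cases[OF C x nb(2) u] and ct = nbhd_inner_cases[OF C x nb(3) u]
    have F': "y \<bullet> y = 1" "z \<bullet> z = 1" "t \<bullet> t = 1" "x \<bullet> y = golden_ratio / 2" "x \<bullet> z = golden_ratio / 2"
       "x \<bullet> t = golden_ratio / 2" "y \<bullet> z = golden_ratio / 2" "y \<bullet> t = golden_ratio / 2" "z \<bullet> t = golden_ratio / 2"
      using F by (simp_all add: golden_frame_def)
    have 1: "\<not> (2 * (y \<bullet> u) = golden_ratio \<and> 2 * (z \<bullet> u) = golden_ratio \<and> 2 * (t \<bullet> u) = golden_ratio)"
      using golden_frame_maximal[OF F uu] ux by (auto simp: inner_commute)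
    \<comment> \<open>Passing to the antipode phi x - u turns the value 1 into phi^2 - 1 = phi,
      which reduces this case to the previous one.\<close>
    have 2: "\<not> (2 * (y \<bullet> u) = 1 \<and> 2 * (z \<bullet> u) = 1 \<and> 2 * (t \<bullet> u) = 1)"
    proof
      assume a: "2 * (y \<bullet> u) = 1 \<and> 2 * (z \<bullet> u) = 1 \<and> 2 * (t \<bullet> u) = 1"
      let ?u = "golden_ratio *\<^sub>R x - u"
      have "?u \<in> nbhd C x" by (rule nbhd_structure(1)[OF C x u])
      then have "?u \<bullet> ?u = 1" "2 * (?u \<bullet> x) = golden_ratio" using cell_like_norm[OF C] by (auto simp: nbhd_def inner_commute)
      moreover have "2 * (?u \<bullet> y) = golden_ratio" "2 * (?u \<bullet> z) = golden_ratio" "2 * (?u \<bullet> t) = golden_ratio"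
      proof -
        have uh: "u \<bullet> y = 1 / 2" "u \<bullet> z = 1 / 2" "u \<bullet> t = 1 / 2" using a by (simp_all add: inner_commute[of u])
        show "2 * (?u \<bullet> y) = golden_ratio" "2 * (?u \<bullet> z) = golden_ratio" "2 * (?u \<bullet> t) = golden_ratio"
          unfolding inner_diff_left inner_scaleR_left F' uh using golden_ratio_square by (simp_all add: field_simps)
      qed
      ultimately show False using golden_frame_maximal[OF F, of ?u] by blast
    qed
    have g: "2 * (a \<bullet> b) = (if a = b then 2 else golden_ratio)" if "a \<in> {y, z, t}" "b \<in> {y, z, t}" for a b
      using golden_frame_inner[OF F, of a b] that by auto
    have g': "2 * (a \<bullet> (golden_ratio *\<^sub>R x - b)) = (if a = b then golden_ratio - 1 else 1)"
      if "a \<in> {y, z, t}" "b \<in> {y, z, t}" for a b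
    proof -
      have ax: "a \<bullet> x = golden_ratio / 2"
        using golden_frame_inner[OF F, of a x] that(1) golden_frame_distinct[OF F] by auto
      have "2 * (a \<bullet> (golden_ratio *\<^sub>R x - b)) = golden_ratio * golden_ratio - 2 * (a \<bullet> b)"
        unfolding inner_diff_right inner_scaleR_right ax by simp
      then show ?thesis using g[OF that] by (simp add: golden_ratio_square)
    qed
    show "u \<in> ?S"
    proof (cases "u \<in> {y, z, t, golden_ratio *\<^sub>R x - y, golden_ratio *\<^sub>R x - z, golden_ratio *\<^sub>R x - t}")
      case True
      then have "(2 * (y \<bullet> u), 2 * (z \<bullet> u), 2 * (t \<bullet> u)) \<in> set frame_patterns"
        using golden_frame_distinct[OF F]
        by (elim insertE emptyE) (simp_all add: g g' frame_patterns_def Let_def)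
      then show ?thesis using ux by blast
    next
      case False
      \<comment> \<open>Of the eight triples with entries phi and 1, the two constant ones have been
        excluded; the other six are listed.\<close>
      then have "2 * (y \<bullet> u) \<in> {golden_ratio, 1}" "2 * (z \<bullet> u) \<in> {golden_ratio, 1}" "2 * (t \<bullet> u) \<in> {golden_ratio, 1}"
        using cy cz ct by auto
      then show ?thesis using 1 2 ux by (auto simp: frame_patterns_def Let_def)
    qed
  qed
  show "card (nbhd C x) = card ?S"
    using card_mono[OF fin sub] le nbhd_card[OF C x] by simp
qed

text \<open>K, made of p and the five common neighbours of p and q, is half of the icosahedron
  around q; the antipodal map r \<mapsto> phi q - r gives the other half. Both are determined by the
  neighbours of p and lie in both codes.\<close>

lemma nbhd_propagate:
  assumes C: "cell_like C" and W: "cell_like W" and p: "p \<in> C" "p \<in> W" and eq: "nbhd C p = nbhd W p"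
    and q: "q \<in> nbhd W p"
  shows "nbhd C q = nbhd W q"
proof -
  define K where "K = insert p {r \<in> nbhd C p. 2 * (q \<bullet> r) = golden_ratio}"
  define K' where "K' = (\<lambda>r. golden_ratio *\<^sub>R q - r) ` K"
  have qC: "q \<in> nbhd C p" using q eq by simp
  have q': "q \<in> C" "q \<in> W" "2 * (q \<bullet> p) = golden_ratio" using qC q by (auto simp: nbhd_def inner_commute)
  have sub: "K \<subseteq> nbhd C q" "K \<subseteq> nbhd W q"
    using p q' eq by (auto simp: K_def nbhd_def)
  then have sub': "K' \<subseteq> nbhd C q" "K' \<subseteq> nbhd W q"
    unfolding K'_def using nbhd_structure(1)[OF C q'(1)] nbhd_structure(1)[OF W q'(2)] by blast+
  have fin: "finite K" using cell_like_finite[OF C] by (simp add: K_def nbhd_def)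
  have pp: "p \<bullet> p = 1" by (rule cell_like_norm[OF C p(1)])
  have "p \<notin> {r \<in> nbhd C p. 2 * (q \<bullet> r) = golden_ratio}"
    using pp golden_ratio_bounds by (simp add: nbhd_def)
  then have cK: "card K = 6"
    using nbhd_structure(2)[OF C p(1) qC] fin unfolding K_def by simp
  have cK': "card K' = 6" unfolding K'_def by (subst card_image) (auto simp: inj_on_def cK)
  \<comment> \<open>Two points of K antipodal about q both differ from p, so they are also antipodal
    about p, which forces p = q.\<close>
  have disj: "K \<inter> K' = {}"
  proof (rule ccontr)
    assume "K \<inter> K' \<noteq> {}"
    then obtain r s where rs: "r \<in> K" "s \<in> K" "s = golden_ratio *\<^sub>R q - r" unfolding K'_def by blast
    then have rn: "r \<in> nbhd C q" "s \<in> nbhd C q" using sub by blast+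
    have ip: "2 * (r \<bullet> s) = golden_ratio - 1" using nbhd_inner_cases(3)[OF C q'(1) rn] rs(3) by blast
    have pK: "2 * (p \<bullet> w) \<noteq> golden_ratio - 1" if "w \<in> K" for w
      using that pp golden_ratio_bounds by (auto simp: K_def nbhd_def)
    have "r \<noteq> p" "s \<noteq> p"
      using ip pK[OF rs(1)] pK[OF rs(2)] by (auto simp: inner_commute)
    then have "r \<in> nbhd C p" "s \<in> nbhd C p" using rs by (auto simp: K_def)
    from nbhd_inner_cases(3)[OF C p(1) this] ip have "s = golden_ratio *\<^sub>R p - r" by blast
    then have "p = q" using rs(3) golden_ratio_bounds by auto
    then show False using q'(3) pp golden_ratio_bounds by simp
  qed
  have c12: "card (K \<union> K') = 12" using fin cK cK' disj by (subst card_Un_disjoint) (auto simp: K'_def)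
  have "K \<union> K' = nbhd D q" if "cell_like D" "K \<union> K' \<subseteq> nbhd D q" "q \<in> D" for D
    using that nbhd_card[OF that(1,3)] c12 cell_like_finite[OF that(1)]
    by (intro card_subset_eq) (auto simp: nbhd_def)
  from this[OF C] this[OF W] sub sub' q' show ?thesis by blast
qed

section \<open>Transport by isometries and comparison with the 600-cell\<close>

lemma cell_like_image:
  assumes f: "orthogonal_transformation f" and C: "cell_like C"
  shows "cell_like (f ` C)"
proof -
  have inj: "inj f" using f by (rule orthogonal_transformation_inj)
  then have inj': "inj_on f C" by (rule inj_on_subset) simp
  have ip: "f u \<bullet> f v = u \<bullet> v" for u v using f by (simp add: orthogonal_transformation_def)
  have "spherical_code (f ` C)"
    using C f by (auto simp: cell_like_def spherical_code_def orthogonal_transformation_norm)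
  moreover have "card (f ` C) = 120" using C card_image[OF inj'] by (simp add: cell_like_def)
  moreover have "pair_sum F (f ` C) = pair_sum F C" for F
    unfolding pair_sum_def by (simp add: sum.reindex[OF inj'] ip)
  ultimately show ?thesis using C unfolding cell_like_def moment_design_def by (auto simp: ip)
qed

lemma cell_like_W120: "cell_like W120"
  using spherical_code_W120 card_W120 W120_moments W120_inner_values
  by (auto simp: cell_like_def moment_design_def)

lemma cell_like_unique:
  assumes C: "cell_like C"
  shows "isometric_codes C W120"
proof -
  have frame: "\<exists>y z t. y \<in> nbhd D x \<and> z \<in> nbhd D x \<and> t \<in> nbhd D x \<and> golden_frame x y z t"
    if D: "cell_like D" and x: "x \<in> D" for D x
  proof -
    obtain y z t where nb: "y \<in> nbhd D x" "z \<in> nbhd D x" "t \<in> nbhd D x" "z \<in> nbhd D y" "t \<in> nbhd D y" "t \<in> nbhd D z"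
      using tetrahedron_exists[OF D x] by blast
    then have "golden_frame x y z t"
      using cell_like_norm[OF D] x by (auto simp: golden_frame_def nbhd_def)
    then show ?thesis using nb by blast
  qed
  have "C \<noteq> {}" using C by (auto simp: cell_like_def)
  then obtain x where x: "x \<in> C" by blast
  from frame[OF C x] obtain y z t where nb: "y \<in> nbhd C x" "z \<in> nbhd C x" "t \<in> nbhd C x"
    and F: "golden_frame x y z t" by blast
  let ?e = "axis 1 1 :: real ^ 4"
  from frame[OF cell_like_W120 axis_1_in_W120] obtain y' z' t' where
    nb': "y' \<in> nbhd W120 ?e" "z' \<in> nbhd W120 ?e" "t' \<in> nbhd W120 ?e" and F': "golden_frame ?e y' z' t'" by blast
  obtain f where f: "orthogonal_transformation f" "f x = ?e" "f y = y'" "f z = z'" "f t = t'"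
    using golden_frame_isometry[OF F F'] by blast
  let ?D = "f ` C"
  have D: "cell_like ?D" by (rule cell_like_image[OF f(1) C])
  have eD: "?e \<in> ?D" using x f(2) by (metis imageI)
  have ip: "f u \<bullet> f v = u \<bullet> v" for u v using f(1) by (simp add: orthogonal_transformation_def)
  have "f u \<in> nbhd ?D ?e" if "u \<in> nbhd C x" for u
    using that ip[of x u] f(2) by (auto simp: nbhd_def)
  from this[OF nb(1)] this[OF nb(2)] this[OF nb(3)]
  have nbD: "y' \<in> nbhd ?D ?e" "z' \<in> nbhd ?D ?e" "t' \<in> nbhd ?D ?e" unfolding f(3-5) .
  have base: "nbhd ?D ?e = nbhd W120 ?e"
    unfolding nbhd_eq_patterns[OF D eD nbD F'] nbhd_eq_patterns[OF cell_like_W120 axis_1_in_W120 nb' F'] ..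
  have "w \<in> ?D \<and> nbhd ?D w = nbhd W120 w" if "w \<in> W120" for w
    using _ _ that
  proof (rule W120_connected_induct[where P = "\<lambda>w. w \<in> ?D \<and> nbhd ?D w = nbhd W120 w"])
    show "?e \<in> ?D \<and> nbhd ?D ?e = nbhd W120 ?e" using eD base by blast
    fix u v assume u: "u \<in> W120" and v: "v \<in> W120" and uv: "2 * (u \<bullet> v) = golden_ratio"
      and IH: "v \<in> ?D \<and> nbhd ?D v = nbhd W120 v"
    have n: "u \<in> nbhd W120 v" using u uv by (simp add: nbhd_def inner_commute)
    then have "u \<in> nbhd ?D v" using IH by simp
    then have "u \<in> ?D" by (simp add: nbhd_def)
    then show "u \<in> ?D \<and> nbhd ?D u = nbhd W120 u"
      using nbhd_propagate[OF D cell_like_W120 _ v _ n] IH by blast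
  qed
  then have "W120 \<subseteq> ?D" by blast
  moreover have "card W120 = card ?D" using D by (simp add: card_W120 cell_like_def)
  ultimately have "W120 = ?D" using cell_like_finite[OF D] by (intro card_subset_eq)
  then show ?thesis using f(1) unfolding isometric_codes_def by blast
qed

text \<open>Strict monotonicity quantifies its derivative sequence separately from the weak one.
  Positivity inside passes to the endpoint -1 by continuity, so the strict sequence can serve both
  purposes.\<close>

lemma abs_mono_seq_of_strict:
  assumes D: "iterated_derivatives h D" and pos: "\<forall>i. \<forall>t\<in>{-1<..<1}. 0 < D i t"
  shows "abs_mono_seq D"
  unfolding abs_mono_seq_def
proof (intro allI ballI conjI)
  fix i and t :: real assume t: "t \<in> {-1..<1}"
  show der: "(D i has_real_derivative D (Suc i) t) (at t within {-1..<1})"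
    using D t by (simp add: iterated_derivatives_def)
  show "0 \<le> D i t"
  proof (cases "t = -1")
    case False
    then show ?thesis using pos t by (auto intro: less_imp_le)
  next
    case True
    have "continuous (at (-1) within {-1..<1}) (D i)"
      using der unfolding True by (rule DERIV_continuous)
    then have "(D i \<longlongrightarrow> D i (-1)) (at (-1) within {-1<..<1})"
      unfolding continuous_within by (rule tendsto_within_subset) auto
    moreover have "at (-1) within {-1<..<(1::real)} \<noteq> bot"
      by (simp add: at_within_eq_bot_iff)
    moreover have "\<forall>\<^sub>F s in at (-1) within {-1<..<1}. 0 \<le> D i s"
      using pos by (auto simp: eventually_at_filter intro!: always_eventually less_imp_le)
    ultimately show ?thesis unfolding True by (intro tendsto_lowerbound)
  qed
qed

theorem theorem5p2:
  shows "(\<forall>h C. absolutely_monotone h \<and> spherical_code C \<and> card C = 120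
            \<longrightarrow> energy h W120 \<le> energy h C) \<and>
         (\<forall>h C. strictly_absolutely_monotone h \<and> spherical_code C \<and> card C = 120 \<and>
              \<not> isometric_codes C W120
            \<longrightarrow> energy h W120 < energy h C)"
proof (intro conjI allI impI)
  fix h C assume *: "absolutely_monotone h \<and> spherical_code C \<and> card C = 120"
  then obtain D where D: "iterated_derivatives h D" "\<forall>i. \<forall>t\<in>{-1..<1}. 0 \<le> D i t"
    by (auto simp: absolutely_monotone_def)
  have am: "abs_mono_seq D" using D by (simp add: abs_mono_seq_def iterated_derivatives_def)
  have h: "h t = ereal (D 0 t)" if "t \<in> {-1..<1}" for t using D(1) that by (simp add: iterated_derivatives_def)
  have energy: "energy h B = ereal (offdiag_sum (\<lambda>s. D 0 (s / 2)) B)" if "spherical_code B" for B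
    using that h by (rule energy_eq_offdiag_sum)
  show "energy h W120 \<le> energy h C"
    using energy_bound(1)[OF am] * by (simp add: energy spherical_code_W120)
next
  fix h C assume *: "strictly_absolutely_monotone h \<and> spherical_code C \<and> card C = 120 \<and> \<not> isometric_codes C W120"
  then obtain D where D: "iterated_derivatives h D" "\<forall>i. \<forall>t\<in>{-1<..<1}. 0 < D i t"
    unfolding strictly_absolutely_monotone_def by blast
  have am: "abs_mono_seq D" by (rule abs_mono_seq_of_strict[OF D])
  have st: "strict_abs_mono_seq D" using D(2) by (simp add: strict_abs_mono_seq_def)
  have h: "h t = ereal (D 0 t)" if "t \<in> {-1..<1}" for t using D(1) that by (simp add: iterated_derivatives_def)
  have energy: "energy h B = ereal (offdiag_sum (\<lambda>s. D 0 (s / 2)) B)" if "spherical_code B" for B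
    using that h by (rule energy_eq_offdiag_sum)
  have "offdiag_sum (\<lambda>s. D 0 (s / 2)) C \<noteq> offdiag_sum (\<lambda>s. D 0 (s / 2)) W120"
    using energy_bound(2)[OF am _ _ st] cell_like_unique * by (auto simp: cell_like_def)
  moreover have "offdiag_sum (\<lambda>s. D 0 (s / 2)) W120 \<le> offdiag_sum (\<lambda>s. D 0 (s / 2)) C"
    using energy_bound(1)[OF am] * by blast
  ultimately show "energy h W120 < energy h C"
    using * by (simp add: energy spherical_code_W120)
qed

end
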